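(* Let $q=2^n$ with $n\ge 3$, let $h$ be a positive integer with $\gcd(n,h)=1$, let $q\equiv\xi\pmod 3$ with $\xi\in\{1,-1\}$, and let the point classes $\mathcal O_i$ and the plane classes $\mathcal O_d^{\mathfrak s}$ of $\mathrm{PG}(3,q)$ be as defined in the context. Through every point of $\mathcal O_1$ there pass exactly $r_{1,d}$ planes of $\mathcal O_d^{\mathfrak s}$, and through every point of $\mathcal O_2$ there pass exactly $r_{2,d}$ planes of $\mathcal O_d^{\mathfrak s}$, where $$r_{1,d}=\begin{cases}1&\text{if } d=q+1,\\ \frac{q(q-\xi)}3&\text{if } d=0,\\ \frac{q(q+\xi)}2&\text{if } d=1,\\ q&\text{if } d=2,\\ \frac{q(q-\xi)}6&\text{if } d=3,\end{cases}\qquad r_{2,d}=\begin{cases}2&\text{if } d=q+1,\\ \frac{q^2-1}3&\text{if } d=0,\\ \frac{q(q-1)}2&\text{if } d=1,\\ 2q-1&\text{if } d=2,\\ \frac{q^2-3q+2}6&\text{if } d=3.\end{cases}$$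
   Context: Points of $\mathrm{PG}(3,q)$ have homogeneous coordinates $(X_1,X_2,X_3,X_4)$; $U_i$ is the point with $1$ in position $i$ and $0$ elsewhere. $\mathcal A=\{P_t=(1,t,t^{2^h},t^{2^h+1})\mid t\in\mathbb F_q\}\cup\{U_4\}$. $\mathfrak s$ is the symplectic polarity of $\mathrm{PG}(3,q)$ defined by the alternating form $x_1y_4+x_2y_3+x_3y_2+x_4y_1$. The osculating planes are the $q+1$ planes $P^{\mathfrak s}$, $P\in\mathcal A$. Put $\mathcal O_{q+1}=\mathcal A$; for $i\in\{0,1,2,3\}$, $\mathcal O_i$ is the set of points of $\mathrm{PG}(3,q)\setminus\mathcal A$ lying on exactly $i$ osculating planes. For $i\in\{0,1,2,3,q+1\}$, $\mathcal O_i^{\mathfrak s}=\{P^{\mathfrak s}\mid P\in\mathcal O_i\}$ (so $\mathcal O_{q+1}^{\mathfrak s}$ is the set of osculating planes). *)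

theory Defs
  imports "HOL-Analysis.Cartesian_Space" "HOL-Number_Theory.Cong"
begin

text \<open>
  PG(3,q) is the lattice of subspaces of \<open>'a ^ 4\<close>, where \<open>'a\<close> is a finite field with
  \<open>q = CARD('a)\<close> elements; a point lies on a plane iff it is a subset of it.
  The literal \<open>4\<close> of the index type \<open>4\<close> equals \<open>0\<close> there, so \<open>1, 2, 3, 4\<close> are its four
  distinct elements and \<open>x $ 1, ..., x $ 4\<close> are the four coordinates.
\<close>

lemma vector_4:
  "(vector [w, x, y, z] :: 'a::zero ^ 4) $ 1 = w"
  "(vector [w, x, y, z] :: 'a::zero ^ 4) $ 2 = x"
  "(vector [w, x, y, z] :: 'a::zero ^ 4) $ 3 = y"
  "(vector [w, x, y, z] :: 'a::zero ^ 4) $ 4 = z"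
  unfolding vector_def by simp_all

definition pg_points :: "('a::field ^ 4) set set" where
  "pg_points = {W. vec.subspace W \<and> vec.dim W = 1}"

definition proj_point :: "'a::field \<Rightarrow> 'a \<Rightarrow> 'a \<Rightarrow> 'a \<Rightarrow> ('a ^ 4) set" where
  "proj_point x\<^sub>1 x\<^sub>2 x\<^sub>3 x\<^sub>4 = vec.span {vector [x\<^sub>1, x\<^sub>2, x\<^sub>3, x\<^sub>4]}"

definition arc :: "nat \<Rightarrow> ('a::field ^ 4) set set" where
  "arc h = {proj_point 1 t (t ^ (2 ^ h)) (t ^ (2 ^ h + 1)) | t. True} \<union> {proj_point 0 0 0 1}"

text \<open>The form is alternating only in characteristic 2, the only case used.\<close>

definition sform :: "'a::field ^ 4 \<Rightarrow> 'a ^ 4 \<Rightarrow> 'a" where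
  "sform x y = x $ 1 * y $ 4 + x $ 2 * y $ 3 + x $ 3 * y $ 2 + x $ 4 * y $ 1"

definition polar :: "('a::field ^ 4) set \<Rightarrow> ('a ^ 4) set" where
  "polar W = {y. \<forall>x\<in>W. sform x y = 0}"

definition osculating_planes :: "nat \<Rightarrow> ('a::field ^ 4) set set" where
  "osculating_planes h = polar ` arc h"

text \<open>Only the indices \<open>0, 1, 2, 3, q + 1\<close> are meaningful.\<close>

definition point_class :: "nat \<Rightarrow> nat \<Rightarrow> ('a::{field,finite} ^ 4) set set" where
  "point_class h i =
     (if i = CARD('a) + 1 then arc h
      else {P \<in> pg_points - arc h. card {\<pi> \<in> osculating_planes h. P \<subseteq> \<pi>} = i})"

definition plane_class :: "nat \<Rightarrow> nat \<Rightarrow> ('a::{field,finite} ^ 4) set set" where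
  "plane_class h d = polar ` point_class h d"

end

(*
  Identify the projective line over F_q with 'a option and put w i j = e_i (x) s(e_j), where s is the
  Frobenius power x -> x^(2^h); the arc consists of the points w i i, and every point w i j lies
  on the hyperbolic quadric x1 x4 = x2 x3. Since sform (w i j) (w k l) is a product of two brackets,
  w i j lies exactly on the osculating planes at i and j, and since x -> s(x)/x permutes the
  nonzero elements, every other point on two osculating planes lies on exactly three. Hence O_2
  is the quadric minus the arc, and the number of points of O_2 in a plane is read off from the
  section of the quadric with that plane. The remaining point classes in the plane polar to P follow
  by counting points, incidences with osculating planes, and incidences with pairs of these. The
  last count needs the number of chords of the arc through P: none if P is in O_2, while for P in
  O_1 chords correspond to solutions of s(z) + z = e + 1 where s(z) + z = e has none, so that
  their number depends on whether s(z) + z = 1 is solvable, that is, on the parity of n.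
*)
theory Submission
  imports Defs "HOL-Computational_Algebra.Primes" "HOL-Computational_Algebra.Polynomial"
begin

section \<open>Fixed points of Frobenius powers in characteristic 2\<close>

text \<open>Translation by 1 permutes the field, so comparing the sums of all elements gives q = 0
  in it. As q is a power of 2, this means 2 = 0.\<close>

lemma CHAR_eq_two:
  assumes "CARD('a::{field,finite}) = 2 ^ n"
  shows "CHAR('a) = 2"
proof -
  have "(\<Sum>y\<in>UNIV. y + (1::'a)) = (\<Sum>y\<in>UNIV. y)"
    by (rule sum.reindex_bij_witness[where i="\<lambda>y. y - 1" and j="\<lambda>y. y + 1"]) auto
  then have "of_nat CARD('a) = (0::'a)"
    by (simp add: sum.distrib)
  then have "of_nat 2 = (0::'a)"
    by (simp add: assms)
  then have "CHAR('a) dvd 2"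
    by (simp only: of_nat_eq_0_iff_char_dvd)
  then have "CHAR('a) = 1 \<or> CHAR('a) = 2"
    using two_is_prime_nat unfolding prime_nat_iff by blast
  then show ?thesis
    using CHAR_not_1' [where 'a='a] by auto
qed

lemma add_self_eq_0:
  assumes "CHAR('a::comm_ring_1) = 2"
  shows "(x::'a) + x = 0"
  using of_nat_eq_0_iff_char_dvd[where 'a='a, of 2] by (simp add: assms flip: mult_2)

text \<open>Multiplication by a nonzero \<open>x\<close> permutes the nonzero elements; comparing
  their products gives \<open>x ^ (q - 1) = 1\<close>.\<close>

lemma finite_field_power_card:
  fixes x :: "'a::{field,finite}"
  shows "x ^ CARD('a) = x"
proof (cases "x = 0")
  case False
  have "(\<Prod>y\<in>UNIV - {0}. x * y) = (\<Prod>y\<in>UNIV - {0}. y)"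
    by (rule prod.reindex_bij_witness[of _ "\<lambda>y. y / x" "\<lambda>y. x * y"]) (use False in auto)
  then have "x ^ (CARD('a) - 1) = 1"
    by (simp add: prod.distrib)
  then show ?thesis
    by (metis One_nat_def finite_UNIV_card_ge_0 finite_class.finite_UNIV mult.right_neutral
        power_eq_if gr_implies_not0)
qed auto

lemma power_power_eq_same:
  assumes "(x::'a::monoid_mult) ^ m = x"
  shows "x ^ (m ^ k) = x"
  by (induction k) (simp_all add: power_mult assms)

text \<open>Take a Bezout relation \<open>h * a = n * b + 1\<close>. Squaring \<open>x\<close> that
  many times gives \<open>x\<close> by the left side and \<open>x ^ 2\<close> by the right side,
  because \<open>n\<close> squarings act as the identity.\<close>

lemma two_power_fixed:
  assumes card: "CARD('a::{field,finite}) = 2 ^ n" and "coprime h n" and "h > 0"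
    and "(x::'a) ^ (2 ^ h) = x"
  shows "x = 0 \<or> x = 1"
proof -
  obtain a b where ab: "h * a = n * b + 1"
    using bezout_nat[of h n] assms(2,3) by auto
  have "x ^ (2 ^ (h * a)) = x"
    using power_power_eq_same[OF assms(4)] by (simp add: power_mult)
  moreover have "x ^ (2 ^ n) = x"
    using finite_field_power_card[of x] card by simp
  then have "x ^ (2 ^ (n * b + 1)) = x ^ 2"
    using power_power_eq_same[of x "2 ^ n" b] unfolding power_add power_mult by simp
  ultimately have "x * x = x" by (simp add: ab power2_eq_square)
  then show ?thesis by simp
qed

text \<open>The map \<open>z -> z ^ (2 ^ h)\<close> adds 1 to \<open>z\<close>, so its
  \<open>n\<close>-th iterate adds \<open>n\<close>. That iterate is also a power of the q-th power
  map, hence the identity, so \<open>n\<close> vanishes in characteristic 2.\<close>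

lemma shifted_fixed_point_even:
  fixes z :: "'a::{field,finite}"
  assumes card: "CARD('a) = 2 ^ n" and z: "z ^ (2 ^ h) + z = 1"
  shows "even n"
proof (rule ccontr)
  assume "odd n"
  note two = add_self_eq_0[OF CHAR_eq_two[OF card]]
  have frob: "(x + y) ^ (2 ^ k) = x ^ (2 ^ k) + y ^ (2 ^ k)" for x y :: 'a and k
    by (rule freshmans_dream') (simp_all add: CHAR_eq_two[OF card])
  have zh: "z ^ (2 ^ h) = z + 1"
    using z two by (metis add.assoc add.commute add.right_neutral)
  have "z ^ (2 ^ (h * k)) = z + of_nat k" for k
  proof (induction k)
    case (Suc k)
    have *: "(of_nat k :: 'a) ^ (2 ^ h) = of_nat k" for k
      by (induction k) (simp_all add: frob add.commute)
    have "z ^ (2 ^ (h * Suc k)) = (z ^ (2 ^ (h * k))) ^ (2 ^ h)"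
      by (simp add: power_add power_mult mult.commute flip: power_mult)
    also have "\<dots> = z + of_nat (Suc k)"
      by (simp add: Suc frob zh * ac_simps)
    finally show ?case .
  qed simp
  moreover have "z ^ (2 ^ (h * n)) = z"
    using power_power_eq_same[of z "2 ^ n" h] finite_field_power_card[of z] card
    unfolding mult.commute[of h] power_mult by simp
  ultimately have "of_nat n = (0::'a)" by simp
  moreover have "(2::'a) = 0" using two[of 1] by simp
  ultimately have "(1::'a) = 0"
    using \<open>odd n\<close> by (auto elim!: oddE)
  then show False by simp
qed

text \<open>For even \<open>n\<close>, 3 divides q - 1 and the field contains a nontrivial cube root
  of unity \<open>z\<close>, so \<open>z ^ 2 + z = 1\<close>. For odd \<open>h\<close>,
  \<open>2 ^ h\<close> is 2 modulo 3, so \<open>z ^ (2 ^ h) = z ^ 2\<close>.\<close>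

lemma shifted_fixed_point_exists:
  assumes card: "CARD('a::{field,finite}) = 2 ^ n" and "n > 0" and "even n" and "odd h"
  shows "\<exists>z::'a. z ^ (2 ^ h) + z = 1"
proof -
  note two = add_self_eq_0[OF CHAR_eq_two[OF card]]
  have four: "(4::nat) ^ k mod 3 = 1" for k
    by (induction k) (simp_all add: mod_mult_right_eq[of 4 _ 3, symmetric])
  obtain m where m: "2 ^ n = 3 * m + (1::nat)"
  proof -
    obtain k where "n = 2 * k" using \<open>even n\<close> by (elim evenE)
    then have "(2::nat) ^ n mod 3 = 1" by (simp add: power_mult four)
    then show ?thesis by (metis that mult_div_mod_eq)
  qed
  have "m > 0" using m \<open>n > 0\<close> by (cases "m = 0") auto
  \<comment> \<open>This polynomial has at most \<open>m\<close> = (q - 1)/3 roots, so some nonzero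
    \<open>x\<close> is not among them; its \<open>m\<close>-th power is the required cube root of
    unity.\<close>
  define p where "p = monom (1::'a) m - 1"
  have deg: "degree p = m"
    unfolding p_def diff_conv_add_uminus using \<open>m > 0\<close>
    by (subst degree_add_eq_left) (simp_all add: degree_monom_eq)
  have "card {x. poly p x = 0} \<le> m"
    using card_poly_roots_bound[of p] deg \<open>m > 0\<close> by (cases "p = 0") auto
  also have "m < card (UNIV - {0::'a})"
    using card m \<open>m > 0\<close> by simp
  finally have "\<not> UNIV - {0} \<subseteq> {x. poly p x = 0}"
    using card_mono[of "{x. poly p x = 0}" "UNIV - {0}"] by auto
  then obtain x where x: "x \<noteq> 0" "poly p x \<noteq> 0"
    by auto
  define z where "z = x ^ m"
  have "z \<noteq> 1" using x by (simp add: z_def p_def poly_monom)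
  have "x * x ^ (3 * m) = x"
    using finite_field_power_card[of x] card m by simp
  then have z3: "z ^ 3 = 1"
    using x by (simp add: z_def mult.commute flip: power_mult)
  then have "(z - 1) * (z ^ 2 + z + 1) = 0"
    by (simp add: algebra_simps power2_eq_square power3_eq_cube)
  then have z2: "z ^ 2 + z = 1"
  proof -
    have "z ^ 2 + z + 1 = 0"
      using \<open>z \<noteq> 1\<close> \<open>(z - 1) * (z ^ 2 + z + 1) = 0\<close> by simp
    moreover have "z ^ 2 + z = (z ^ 2 + z + 1) + 1"
      by (simp add: add.assoc two)
    ultimately show ?thesis by simp
  qed
  obtain l where l: "2 ^ h = 3 * l + (2::nat)"
  proof -
    obtain k where "h = 2 * k + 1" using \<open>odd h\<close> by (elim oddE)
    then have "(2::nat) ^ h mod 3 = 2"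
      using four[of k] mod_mult_right_eq[of 2 "4 ^ k" "3::nat"] by (simp add: power_mult)
    then show ?thesis by (metis that mult_div_mod_eq)
  qed
  have "z ^ (2 ^ h) = z ^ 2"
    unfolding l power_add power_mult z3 by simp
  with z2 show ?thesis by (intro exI[of _ z]) simp
qed

text \<open>Isolates the properties of \<open>x -> x ^ (2 ^ h)\<close> on which the geometry rests.
  The assumption on fixed points is the form in which the coprimality of \<open>n\<close> and
  \<open>h\<close> enters.\<close>

locale frobenius_arc =
  fixes \<sigma> :: "'a::{field,finite} \<Rightarrow> 'a"
  assumes add_self [simp]: "(x::'a) + x = 0"
    and \<sigma>_add [simp]: "\<sigma> (x + y) = \<sigma> x + \<sigma> y"
    and \<sigma>_mult [simp]: "\<sigma> (x * y) = \<sigma> x * \<sigma> y"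
    and \<sigma>_one [simp]: "\<sigma> 1 = 1"
    and \<sigma>_fixed: "\<sigma> x = x \<Longrightarrow> x = 0 \<or> x = 1"
begin

lemma add_self_left [simp]: "(x::'a) + (x + y) = y"
  by (simp flip: add.assoc)

lemma add_eq_0_iff_eq [simp]: "(x::'a) + y = 0 \<longleftrightarrow> x = y"
  by (metis add_self add_left_cancel)

lemma \<sigma>_zero [simp]: "\<sigma> 0 = 0"
  using \<sigma>_add[of 0 0] by (simp del: \<sigma>_add)

lemma \<sigma>_eq_0_iff [simp]: "\<sigma> x = 0 \<longleftrightarrow> x = 0"
proof
  assume "\<sigma> x = 0"
  show "x = 0"
  proof (rule ccontr)
    assume "x \<noteq> 0"
    then have "\<sigma> x * \<sigma> (1 / x) = 1" by (simp flip: \<sigma>_mult)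
    with \<open>\<sigma> x = 0\<close> show False by simp
  qed
qed simp

lemma \<sigma>_eq_iff [simp]: "\<sigma> x = \<sigma> y \<longleftrightarrow> x = y"
  by (metis \<sigma>_add \<sigma>_eq_0_iff add_eq_0_iff_eq)

lemma \<sigma>_divide [simp]: "\<sigma> (x / y) = \<sigma> x / \<sigma> y"
  by (cases "y = 0") (simp_all add: eq_divide_eq flip: \<sigma>_mult)

lemma \<sigma>_surj: obtains x where "\<sigma> x = y"
proof -
  have "surj \<sigma>" by (rule finite_UNIV_inj_surj) (auto intro: injI)
  then show ?thesis using that by (metis surjD)
qed

text \<open>The equation says that \<open>x / y\<close> is fixed by \<sigma>, so this nonzero
  quotient is 1.\<close>

lemma \<sigma>_quotient_unique:
  assumes "x \<noteq> 0" "y \<noteq> 0" "\<sigma> x * y = \<sigma> y * x"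
  shows "x = y"
proof -
  have "\<sigma> (x / y) = x / y" using assms by (simp add: field_simps)
  then show ?thesis using assms \<sigma>_fixed by fastforce
qed

text \<open>By the uniqueness just shown, \<open>x -> \<sigma> x / x\<close> is an injective
  self-map of the finite set of nonzero elements, hence onto.\<close>

lemma \<sigma>_quotient_exists:
  assumes "r \<noteq> 0"
  obtains x where "x \<noteq> 0" "\<sigma> x = r * x"
proof -
  have "inj_on (\<lambda>x. \<sigma> x / x) (UNIV - {0})"
    by (rule inj_onI) (auto simp: field_simps intro: \<sigma>_quotient_unique)
  moreover have "(\<lambda>x. \<sigma> x / x) ` (UNIV - {0}) \<subseteq> UNIV - {0}" by auto
  ultimately have "(\<lambda>x. \<sigma> x / x) ` (UNIV - {0}) = UNIV - {0}"
    by (intro endo_inj_surj) auto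
  then have "r \<in> (\<lambda>x. \<sigma> x / x) ` (UNIV - {0})" using assms by blast
  then obtain x where "x \<in> UNIV - {0}" "r = \<sigma> x / x" by blast
  then show ?thesis using that[of x] by simp
qed

text \<open>The map \<open>z -> \<sigma> z + z\<close> is additive with kernel {0, 1}, so its image
  has index 2. For \<open>e\<close> outside the image, \<open>e + 1\<close> is inside exactly when 1
  is outside, and then its fibre is a coset of the kernel.\<close>

lemma card_shifted_fixed_points:
  assumes "\<And>z. \<sigma> z + z \<noteq> e"
  shows "card {z. \<sigma> z + z = e + 1} = (if \<exists>z. \<sigma> z + z = 1 then 0 else 2)"
proof -
  define L where "L z = \<sigma> z + z" for z
  have L_add: "L (x + y) = L x + L y" for x y
    by (simp add: L_def ac_simps)
  have L_ker: "L x = 0 \<longleftrightarrow> x = 0 \<or> x = 1" for x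
    using \<sigma>_fixed[of x] by (auto simp: L_def)
  have fibre: "{z. L z = L x} = {x, x + 1}" for x
  proof -
    have "L z = L x \<longleftrightarrow> L (z + x) = 0" for z by (simp add: L_add)
    also have "\<dots> z \<longleftrightarrow> z = x \<or> z = x + 1" for z
    proof -
      have "z + x = 1 \<longleftrightarrow> z = x + 1"
        by (metis add.commute add_self_left)
      then show ?thesis by (simp add: L_ker)
    qed
    finally show ?thesis by auto
  qed
  have card_fibre: "card {z. L z = L x} = 2" for x
    unfolding fibre by simp
  have no_e: "e \<notin> range L" using assms by (auto simp: L_def)
  show ?thesis
  proof (cases "\<exists>z. \<sigma> z + z = 1")
    case True
    then obtain u where "L u = 1" by (auto simp: L_def)
    have "L z \<noteq> e + 1" for z
    proof
      assume "L z = e + 1"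
      then have "L (z + u) = e" using \<open>L u = 1\<close> by (simp add: L_add add.assoc)
      then show False using no_e by blast
    qed
    with True show ?thesis by (simp add: L_def)
  next
    case False
    have "card (UNIV::'a set) = (\<Sum>y\<in>range L. card {z. L z = y})"
      using sum.group[of UNIV "range L" L "\<lambda>_. 1::nat"] by simp
    also have "\<dots> = (\<Sum>y\<in>range L. 2)"
      by (rule sum.cong) (auto simp: card_fibre)
    finally have card_range: "CARD('a) = 2 * card (range L)" by simp
    \<comment> \<open>If 1, \<open>e\<close> and \<open>e + 1\<close> were all outside the image,
      its translates by 0, \<open>e\<close> and \<open>e + 1\<close> would be disjoint, which index
      2 forbids.\<close>
    have "e + 1 \<in> range L"
    proof (rule ccontr)
      assume "e + 1 \<notin> range L"
      have inj: "inj_on ((+) c) A" for c :: 'a and A by (simp add: inj_on_def)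
      have no_1: "1 \<notin> range L" using False by (auto simp: L_def)
      have shift: "c + d \<in> range L" if "x \<in> (+) c ` range L" "x \<in> (+) d ` range L" for x c d
      proof -
        obtain a b where "x = c + L a" "x = d + L b" using \<open>x \<in> (+) c ` _\<close> \<open>x \<in> (+) d ` _\<close> by blast
        then have "c + d = c + d + (c + L a + (d + L b))" by simp
        also have "\<dots> = L (a + b)" by (simp add: L_add ac_simps)
        finally show ?thesis by simp
      qed
      have d1: "range L \<inter> (+) e ` range L = {}"
        using no_e shift[of _ 0 e] by (auto simp: image_image)
      have d2: "(range L \<union> (+) e ` range L) \<inter> (+) (e + 1) ` range L = {}"
      proof -
        have "x \<notin> (+) (e + 1) ` range L" if "x \<in> range L \<union> (+) e ` range L" for x
          using that no_1 \<open>e + 1 \<notin> range L\<close> shift[of x 0 "e + 1"] shift[of x e "e + 1"]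
          unfolding image_add_0 add_self_left add_0 Un_iff by blast
        then show ?thesis by blast
      qed
      have "card (range L \<union> (+) e ` range L \<union> (+) (e + 1) ` range L) = 3 * card (range L)"
        using d1 d2 by (simp add: card_Un_disjoint card_image inj)
      moreover have "card (range L \<union> (+) e ` range L \<union> (+) (e + 1) ` range L) \<le> CARD('a)"
        by (rule card_mono) auto
      moreover have "card (range L) > 0" by (simp add: card_gt_0_iff)
      ultimately show False using card_range by simp
    qed
    then show ?thesis using False card_fibre by (auto simp: L_def)
  qed
qed

end

section \<open>The projective line and the hyperbolic quadric\<close>

text \<open>The pair (\<open>lo i\<close>, \<open>hi i\<close>) gives homogeneous coordinates on the
  projective line, with \<open>None\<close> as the point at infinity.\<close>

definition lo :: "'a::field option \<Rightarrow> 'a" where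
  "lo i = (case i of None \<Rightarrow> 0 | Some _ \<Rightarrow> 1)"

definition hi :: "'a::field option \<Rightarrow> 'a" where
  "hi i = (case i of None \<Rightarrow> 1 | Some t \<Rightarrow> t)"

text \<open>The 2 by 2 determinant of two points of the line, with a plus sign because the
  characteristic will be 2.\<close>

definition bracket :: "'a::field option \<Rightarrow> 'a option \<Rightarrow> 'a" where
  "bracket i j = lo i * hi j + hi i * lo j"

lemma vec4_eq_iff: "x = y \<longleftrightarrow> x $ 1 = y $ 1 \<and> x $ 2 = y $ 2 \<and> x $ 3 = y $ 3 \<and> x $ 4 = y $ 4"
  for x y :: "'a ^ 4"
  by (simp add: vec_eq_iff forall_4)

lemma card_UNIV_option [simp]: "card (UNIV :: 'a::finite option set) = CARD('a) + 1"
  by (simp add: UNIV_option_conv card_image)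

lemma sform_add_left [simp]: "sform (x + y) z = sform x z + sform y z"
  and sform_scale_left [simp]: "sform (c *s x) z = c * sform x z"
  and sform_add_right [simp]: "sform z (x + y) = sform z x + sform z y"
  and sform_scale_right [simp]: "sform z (c *s x) = c * sform z x"
  and sform_diff_right [simp]: "sform z (x - y) = sform z x - sform z y"
  and sform_zero_left [simp]: "sform 0 z = 0"
  and sform_zero_right [simp]: "sform z 0 = 0"
  by (simp_all add: sform_def algebra_simps)

lemma sform_commute: "sform x y = sform y x"
  by (simp add: sform_def algebra_simps)

context frobenius_arc
begin

lemma bracket_eq_0_iff [simp]: "bracket i j = 0 \<longleftrightarrow> i = (j :: 'a option)"
  by (auto simp: bracket_def lo_def hi_def split: option.splits)

lemma bracket_self [simp]: "bracket i i = (0::'a)" by simp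

lemma bracket_commute: "bracket i j = (bracket j i :: 'a)"
  by (simp add: bracket_def algebra_simps)

text \<open>The three-term Pluecker relation without signs; it makes the affine coordinate
  \<open>coord\<close> injective.\<close>

lemma bracket_pluecker:
  "bracket j k * bracket i l + bracket j l * bracket i k = bracket i j * (bracket k l :: 'a)"
  by (simp add: bracket_def algebra_simps)

definition w :: "'a option \<Rightarrow> 'a option \<Rightarrow> 'a ^ 4" where
  "w i j = vector [lo i * \<sigma> (lo j), hi i * \<sigma> (lo j), lo i * \<sigma> (hi j), hi i * \<sigma> (hi j)]"

lemma sform_w_w [simp]: "sform (w i j) (w k l) = bracket i k * \<sigma> (bracket j l)"
  by (simp add: sform_def w_def vector_4 bracket_def algebra_simps)

text \<open>The four vectors form a basis in which \<open>w i i\<close> pairs only with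
  \<open>w j j\<close>, and \<open>w i j\<close> only with \<open>w j i\<close>, both with the same
  value. Hence the coordinates of \<open>y\<close> are form values up to this common factor.\<close>

lemma w_expansion:
  fixes y :: "'a ^ 4"
  assumes "i \<noteq> j"
  shows "y = (1 / (bracket i j * \<sigma> (bracket i j))) *s
    (sform y (w j j) *s w i i + sform y (w j i) *s w i j
      + sform y (w i j) *s w j i + sform y (w i i) *s w j j)"
proof -
  have "(bracket i j * \<sigma> (bracket i j)) *s y =
    sform y (w j j) *s w i i + sform y (w j i) *s w i j
      + sform y (w i j) *s w j i + sform y (w i i) *s w j j"
    unfolding vec4_eq_iff
    by (simp add: sform_def w_def vector_4 bracket_def algebra_simps)
  moreover have "bracket i j * \<sigma> (bracket i j) \<noteq> 0" using assms by simp
  ultimately show ?thesis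
    by (metis (no_types) divide_self mult.commute times_divide_eq_right mult_1_right vector_smult_assoc vector_smult_lid)
qed

lemma w_expansionE:
  fixes y :: "'a ^ 4"
  assumes "i \<noteq> j"
  obtains a b c d where
    "y = a *s w i i + b *s w i j + c *s w j i + d *s w j j"
    "a = 0 \<longleftrightarrow> sform y (w j j) = 0" "b = 0 \<longleftrightarrow> sform y (w j i) = 0"
    "c = 0 \<longleftrightarrow> sform y (w i j) = 0" "d = 0 \<longleftrightarrow> sform y (w i i) = 0"
proof -
  define r where "r = 1 / (bracket i j * \<sigma> (bracket i j))"
  have "r \<noteq> 0" using assms by (simp add: r_def)
  show ?thesis
    by (rule that[of "r * sform y (w j j)" "r * sform y (w j i)" "r * sform y (w i j)" "r * sform y (w i i)"])
      (use w_expansion[OF assms, of y] \<open>r \<noteq> 0\<close> in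
        \<open>simp_all add: vector_add_ldistrib vector_smult_assoc flip: r_def\<close>)
qed

lemma option_neq: obtains j where "j \<noteq> (i :: 'a option)"
  by (metis option.distinct(1) not_Some_eq)

lemma w_nonzero [simp]: "w i j \<noteq> 0"
proof
  assume "w i j = 0"
  obtain k l where "k \<noteq> i" "l \<noteq> j" by (metis option_neq)
  then have "sform (w i j) (w k l) \<noteq> 0" by auto
  with \<open>w i j = 0\<close> show False by simp
qed

text \<open>The affine coordinate on the projective line minus \<open>i\<close> that vanishes at \<open>j\<close>.\<close>

definition coord :: "'a option \<Rightarrow> 'a option \<Rightarrow> 'a option \<Rightarrow> 'a" where
  "coord i j k = bracket j k / bracket i k"

lemma coord_eq_0_iff: "k \<noteq> i \<Longrightarrow> coord i j k = 0 \<longleftrightarrow> k = j"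
  by (auto simp: coord_def)

text \<open>Equal coordinates of \<open>k\<close> and \<open>l\<close> force
  \<open>bracket i j * bracket k l = 0\<close> by the Pluecker relation; surjectivity follows since
  both sides have q elements.\<close>

lemma coord_bij:
  assumes "i \<noteq> j"
  shows "bij_betw (coord i j) (- {i}) UNIV"
proof -
  have inj: "inj_on (coord i j) (- {i})"
  proof (rule inj_onI)
    fix k l assume "k \<in> - {i}" "l \<in> - {i}" "coord i j k = coord i j l"
    then have "bracket j k * bracket i l = bracket j l * bracket i k"
      by (simp add: coord_def frac_eq_eq)
    then have "bracket i j * bracket k l = 0"
      using bracket_pluecker[of j k i l] by simp
    then show "k = l" using assms by simp
  qed
  moreover have "card (- {i}) = CARD('a)"
    by (simp add: Compl_eq_Diff_UNIV)
  ultimately have "coord i j ` (- {i}) = UNIV"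
    by (intro card_subset_eq) (simp_all add: card_image)
  with inj show ?thesis by (simp add: bij_betw_def)
qed

lemma coord_surj:
  assumes "i \<noteq> j"
  obtains k where "k \<noteq> i" "coord i j k = x"
  using coord_bij[OF assms] unfolding bij_betw_def by (metis ComplD UNIV_I imageE singletonI)

text \<open>For nonzero \<open>y\<close>, these index the osculating planes through the point
  spanned by \<open>y\<close>; for \<open>y = 0\<close> every index is a root.\<close>

definition roots :: "'a ^ 4 \<Rightarrow> 'a option set" where
  "roots y = {k. sform y (w k k) = 0}"

lemma roots_scale [simp]: "c \<noteq> 0 \<Longrightarrow> roots (c *s y) = roots y"
  by (simp add: roots_def)

lemma roots_w [simp]: "roots (w i j) = {i, j}"
  by (auto simp: roots_def)

text \<open>The root \<open>i\<close> kills the coefficient of \<open>w j j\<close> and the root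
  \<open>j\<close> that of \<open>w i i\<close>; the line common to the two osculating planes joins
  \<open>w i j\<close> and \<open>w j i\<close>.\<close>

lemma roots_two:
  assumes "i \<in> roots y" "j \<in> roots y" "i \<noteq> j"
  obtains b c where "y = b *s w i j + c *s w j i"
proof -
  obtain a b c d where "y = a *s w i i + b *s w i j + c *s w j i + d *s w j j"
    "a = 0 \<longleftrightarrow> sform y (w j j) = 0" "d = 0 \<longleftrightarrow> sform y (w i i) = 0"
    by (rule w_expansionE[OF \<open>i \<noteq> j\<close>, of y])
  then show ?thesis using assms(1,2) by (intro that[of b c]) (simp add: roots_def)
qed

text \<open>In the coordinate \<open>x\<close>, a third root satisfies \<open>b * \<sigma> x = c * x\<close>, which has
  exactly one nonzero solution.\<close>

lemma card_roots_three:
  assumes "i \<noteq> j" "b \<noteq> 0" "c \<noteq> 0"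
  shows "card (roots (b *s w i j + c *s w j i)) = 3"
proof -
  obtain x where x: "x \<noteq> 0" "\<sigma> x = c / b * x"
    using \<sigma>_quotient_exists[of "c / b"] assms by auto
  obtain k where k: "k \<noteq> i" "coord i j k = x"
    using coord_surj[OF \<open>i \<noteq> j\<close>] .
  have "k \<noteq> j" using k x coord_eq_0_iff by auto
  have root_iff: "l \<in> roots (b *s w i j + c *s w j i) \<longleftrightarrow> b * \<sigma> (coord i j l) = c * coord i j l"
    if "l \<noteq> i" for l
  proof -
    have "b * \<sigma> (coord i j l) = c * coord i j l \<longleftrightarrow>
      b * (bracket i l * \<sigma> (bracket j l)) = c * (bracket j l * \<sigma> (bracket i l))"
      using that by (simp add: coord_def field_simps)
    then show ?thesis by (simp add: roots_def)
  qed
  have "l \<in> roots (b *s w i j + c *s w j i) \<longleftrightarrow> l = i \<or> l = j \<or> l = k" for l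
  proof (cases "l = i \<or> l = j")
    case False
    then have *: "coord i j l \<noteq> 0" by (simp add: coord_eq_0_iff)
    have "l \<in> roots (b *s w i j + c *s w j i) \<longleftrightarrow> \<sigma> (coord i j l) = c / b * coord i j l"
      using root_iff False assms by (simp add: field_simps)
    also have "\<dots> \<longleftrightarrow> coord i j l = x"
    proof
      assume "\<sigma> (coord i j l) = c / b * coord i j l"
      then have "\<sigma> (coord i j l) * x = \<sigma> x * coord i j l"
        unfolding x(2) by (simp only: mult_ac)
      then show "coord i j l = x" by (rule \<sigma>_quotient_unique[OF * x(1)])
    qed (use x in simp)
    also have "\<dots> \<longleftrightarrow> l = k"
      using coord_bij[OF \<open>i \<noteq> j\<close>] False k by (auto simp: bij_betw_def inj_on_def)
    finally show ?thesis using False by simp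
  qed (auto simp: roots_def)
  then have "roots (b *s w i j + c *s w j i) = {i, j, k}" by auto
  then show ?thesis using k \<open>k \<noteq> j\<close> \<open>i \<noteq> j\<close> by simp
qed

text \<open>On the line common to two osculating planes, the two points \<open>w i j\<close> and
  \<open>w j i\<close> have only these two roots, and all others have exactly three.\<close>

lemma card_roots_ge_two:
  assumes "y \<noteq> 0" "card (roots y) \<ge> 2"
  shows "card (roots y) = 3 \<or> (\<exists>c i j. c \<noteq> 0 \<and> i \<noteq> j \<and> y = c *s w i j)"
proof -
  obtain i j where ij: "i \<in> roots y" "j \<in> roots y" "i \<noteq> j"
    using assms(2) card_le_Suc0_iff_eq[of "roots y"] by fastforce
  obtain b c where y: "y = b *s w i j + c *s w j i" using roots_two[OF ij] .
  show ?thesis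
  proof (cases "b = 0 \<or> c = 0")
    case True
    then have "y = c *s w j i \<or> y = b *s w i j" using y by auto
    then show ?thesis using ij(3) \<open>y \<noteq> 0\<close> by (metis vector_smult_lzero)
  next
    case False
    then show ?thesis using y card_roots_three ij(3) by auto
  qed
qed

lemma card_roots_le_three: "y \<noteq> 0 \<Longrightarrow> card (roots y) \<le> 3"
  using card_roots_ge_two[of y] by (cases "card (roots y) \<ge> 2") auto

lemma card_roots_eq_two_iff:
  assumes "y \<noteq> 0"
  shows "card (roots y) = 2 \<longleftrightarrow> (\<exists>c i j. c \<noteq> 0 \<and> i \<noteq> j \<and> y = c *s w i j)"
  using card_roots_ge_two[OF assms] by auto

end

section \<open>Counting vectors in a plane\<close>

lemma sform_nondegenerate:
  assumes "\<And>y. sform p y = 0"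
  shows "p = 0"
proof -
  have "p $ 1 = 0" using assms[of "vector [0, 0, 0, 1]"] by (simp add: sform_def vector_4)
  moreover have "p $ 2 = 0" using assms[of "vector [0, 0, 1, 0]"] by (simp add: sform_def vector_4)
  moreover have "p $ 3 = 0" using assms[of "vector [0, 1, 0, 0]"] by (simp add: sform_def vector_4)
  moreover have "p $ 4 = 0" using assms[of "vector [1, 0, 0, 0]"] by (simp add: sform_def vector_4)
  ultimately show ?thesis by (simp add: vec4_eq_iff)
qed

lemma subspace_perp: "vec.subspace {y. sform p y = 0}"
  by (simp add: vec.subspace_def)

text \<open>\<open>V\<close> is the direct sum of the line of \<open>y0\<close> and the kernel of
  the linear form on \<open>V\<close>.\<close>

lemma card_hyperplane_section:
  fixes V :: "('a::{field,finite} ^ 4) set"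
  assumes V: "vec.subspace V" and y0: "y0 \<in> V" "sform p y0 \<noteq> 0"
  shows "card V = CARD('a) * card {y \<in> V. sform p y = 0}"
proof -
  have "bij_betw (\<lambda>(c, k). c *s y0 + k) ((UNIV :: 'a set) \<times> {y \<in> V. sform p y = 0}) V"
  proof (rule bij_betw_byWitness[where f' = "\<lambda>y. (sform p y / sform p y0, y - (sform p y / sform p y0) *s y0)"])
    show "\<forall>y\<in>V. (case (sform p y / sform p y0, y - (sform p y / sform p y0) *s y0) of
        (c, k) \<Rightarrow> c *s y0 + k) = y"
      by simp
    show "(\<lambda>(c, k). c *s y0 + k) ` (UNIV \<times> {y \<in> V. sform p y = 0}) \<subseteq> V"
      using V y0 by (auto intro: vec.subspace_add vec.subspace_scale)
    show "(\<lambda>y. (sform p y / sform p y0, y - (sform p y / sform p y0) *s y0)) ` V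
        \<subseteq> UNIV \<times> {y \<in> V. sform p y = 0}"
      using V y0 by (auto intro!: vec.subspace_diff vec.subspace_scale)
  qed (use y0 in auto)
  then have "card ((UNIV :: 'a set) \<times> {y \<in> V. sform p y = 0}) = card V" by (rule bij_betw_same_card)
  then show ?thesis by (simp add: card_cartesian_product)
qed

lemma card_perp:
  fixes p :: "'a::{field,finite} ^ 4"
  assumes "p \<noteq> 0"
  shows "card {y. sform p y = 0} = CARD('a) ^ 3"
proof -
  obtain y0 where "sform p y0 \<noteq> 0" using sform_nondegenerate assms by metis
  then have "CARD('a) ^ 4 = CARD('a) * card {y. sform p y = 0}"
    using card_hyperplane_section[of UNIV y0 p] by simp
  then show ?thesis by (simp add: power_numeral_reduce)
qed

lemma sum_card_swap:
  assumes "finite A" "finite B"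
  shows "(\<Sum>x\<in>A. card {y \<in> B. R x y}) = (\<Sum>y\<in>B. card {x \<in> A. R x y})"
proof -
  have "(\<Sum>x\<in>A. card {y \<in> B. R x y}) = (\<Sum>x\<in>A. \<Sum>y\<in>B. if R x y then 1 else 0)"
    using assms by (simp add: sum.If_cases Collect_conj_eq)
  also have "\<dots> = (\<Sum>y\<in>B. \<Sum>x\<in>A. if R x y then 1 else 0)" by (rule sum.swap)
  also have "\<dots> = (\<Sum>y\<in>B. card {x \<in> A. R x y})"
    using assms by (simp add: sum.If_cases Collect_conj_eq)
  finally show ?thesis .
qed

lemma card_off_diagonal:
  assumes "finite R"
  shows "card {(i, j). i \<noteq> j \<and> i \<in> R \<and> j \<in> R} = card R * (card R - 1)"
proof -
  have "{(i, j). i \<noteq> j \<and> i \<in> R \<and> j \<in> R} = (SIGMA i:R. R - {i})" by auto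
  then show ?thesis using assms by simp
qed

context frobenius_arc
begin

text \<open>For distinct indices, the points of the chord joining two arc points, endpoints
  included.\<close>

definition secant :: "'a ^ 4 \<Rightarrow> 'a option \<Rightarrow> 'a option \<Rightarrow> bool" where
  "secant p i j \<longleftrightarrow> (\<exists>a b. p = a *s w i i + b *s w j j)"

definition on_arc :: "'a ^ 4 \<Rightarrow> bool" where
  "on_arc p \<longleftrightarrow> (\<exists>c i. c \<noteq> 0 \<and> p = c *s w i i)"

lemma on_arcI:
  assumes "p = c *s w i i" "p \<noteq> 0"
  shows "on_arc p"
proof -
  have "c \<noteq> 0" using assms by auto
  with assms(1) show ?thesis unfolding on_arc_def by blast
qed

text \<open>As \<open>p\<close> is not proportional to \<open>w i i\<close>, its polar plane differs
  from the osculating plane at \<open>i\<close>; the vector \<open>y0\<close> found below lies in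
  the latter only.\<close>

lemma card_perp_w:
  fixes p :: "'a ^ 4"
  assumes "p \<noteq> 0" "\<not> on_arc p"
  shows "card {y. sform p y = 0 \<and> i \<in> roots y} = CARD('a) ^ 2"
proof -
  obtain j where "j \<noteq> i" using option_neq .
  obtain a b c d where p: "p = a *s w i i + b *s w i j + c *s w j i + d *s w j j"
    and coeffs: "b = 0 \<longleftrightarrow> sform p (w j i) = 0" "c = 0 \<longleftrightarrow> sform p (w i j) = 0" "d = 0 \<longleftrightarrow> sform p (w i i) = 0"
    by (rule w_expansionE[OF \<open>j \<noteq> i\<close>[symmetric], of p])
  have "\<not> (b = 0 \<and> c = 0 \<and> d = 0)"
  proof
    assume "b = 0 \<and> c = 0 \<and> d = 0"
    with p have "p = a *s w i i" by simp
    then show False using on_arcI assms by blast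
  qed
  then obtain y0 where "y0 \<in> {w j i, w i j, w i i}" "sform p y0 \<noteq> 0"
    using coeffs by auto
  then have "CARD('a) ^ 3 = CARD('a) * card {y \<in> {y. sform (w i i) y = 0}. sform p y = 0}"
    using card_hyperplane_section[OF subspace_perp[of "w i i"], of y0 p] card_perp[of "w i i"] by auto
  moreover have "{y \<in> {y. sform (w i i) y = 0}. sform p y = 0} = {y. sform p y = 0 \<and> i \<in> roots y}"
    by (auto simp: roots_def sform_commute[of "w i i"])
  ultimately show ?thesis by (simp add: power2_eq_square power3_eq_cube)
qed

lemma card_two_roots:
  assumes "i \<noteq> j"
  shows "card {y. i \<in> roots y \<and> j \<in> roots y} = CARD('a) ^ 2"
proof -
  have "bij_betw (\<lambda>(b, c). b *s w i j + c *s w j i) UNIV {y. i \<in> roots y \<and> j \<in> roots y}"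
    unfolding bij_betw_def
  proof
    show "inj (\<lambda>(b, c). b *s w i j + c *s w j i)"
    proof (rule injI, clarify)
      fix b c b' c'
      assume eq: "b *s w i j + c *s w j i = b' *s w i j + c' *s w j i"
      show "b = b' \<and> c = c'"
        using arg_cong[OF eq, of "\<lambda>y. sform y (w j i)"] arg_cong[OF eq, of "\<lambda>y. sform y (w i j)"] assms
        by (simp del: \<sigma>_mult)
    qed
    show "range (\<lambda>(b, c). b *s w i j + c *s w j i) = {y. i \<in> roots y \<and> j \<in> roots y}" (is "_ = ?Y")
    proof
      show "range (\<lambda>(b, c). b *s w i j + c *s w j i) \<subseteq> ?Y" by (auto simp: roots_def)
      show "?Y \<subseteq> range (\<lambda>(b, c). b *s w i j + c *s w j i)"
      proof
        fix y assume "y \<in> ?Y"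
        then obtain b c where "y = b *s w i j + c *s w j i"
          using roots_two assms by blast
        then show "y \<in> range (\<lambda>(b, c). b *s w i j + c *s w j i)" by auto
      qed
    qed
  qed
  then have "card (UNIV :: ('a \<times> 'a) set) = card {y. i \<in> roots y \<and> j \<in> roots y}"
    by (rule bij_betw_same_card)
  then show ?thesis by (simp add: power2_eq_square)
qed

text \<open>The line common to the osculating planes at \<open>i\<close> and \<open>j\<close> is the
  polar line of the chord. It therefore lies in the polar plane of \<open>p\<close> exactly when
  \<open>p\<close> is on the chord, and otherwise meets it in one point.\<close>

lemma card_perp_two_roots:
  assumes "i \<noteq> j"
  shows "card {y. sform p y = 0 \<and> i \<in> roots y \<and> j \<in> roots y}
    = (if secant p i j then CARD('a) ^ 2 else CARD('a))"
proof (cases "sform p (w i j) = 0 \<and> sform p (w j i) = 0")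
  case True
  obtain a b c d where p: "p = a *s w i i + b *s w i j + c *s w j i + d *s w j j"
    and "b = 0 \<longleftrightarrow> sform p (w j i) = 0" "c = 0 \<longleftrightarrow> sform p (w i j) = 0"
    by (rule w_expansionE[OF assms, of p])
  with True have "b = 0" "c = 0" by blast+
  with p have "p = a *s w i i + d *s w j j" by simp
  then have "secant p i j" unfolding secant_def by blast
  have "sform p y = 0" if "i \<in> roots y" "j \<in> roots y" for y
    using roots_two[OF that assms] True by (metis mult_zero_right add.right_neutral sform_add_right sform_scale_right)
  then have "{y. sform p y = 0 \<and> i \<in> roots y \<and> j \<in> roots y} = {y. i \<in> roots y \<and> j \<in> roots y}"
    by auto
  then show ?thesis using card_two_roots[OF assms] \<open>secant p i j\<close> by simp
next
  case False
  then have "\<not> secant p i j" by (auto simp: secant_def)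
  let ?V = "{y. i \<in> roots y \<and> j \<in> roots y}"
  obtain y0 where "y0 \<in> {w i j, w j i}" "sform p y0 \<noteq> 0" using False by auto
  moreover have "vec.subspace ?V" by (auto simp: vec.subspace_def roots_def)
  ultimately have "CARD('a) ^ 2 = CARD('a) * card {y \<in> ?V. sform p y = 0}"
    using card_hyperplane_section[of ?V y0 p] card_two_roots[OF assms] by auto
  moreover have "{y \<in> ?V. sform p y = 0} = {y. sform p y = 0 \<and> i \<in> roots y \<and> j \<in> roots y}" by auto
  ultimately show ?thesis using \<open>\<not> secant p i j\<close> by (simp add: power2_eq_square)
qed

section \<open>Counting equations in the polar plane of a point\<close>

definition perp :: "'a ^ 4 \<Rightarrow> ('a ^ 4) set" where
  "perp p = {y. y \<noteq> 0 \<and> sform p y = 0}"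

text \<open>Vectors are counted, so each point contributes q - 1; arc points are included and have
  one root.\<close>

definition perp_count :: "'a ^ 4 \<Rightarrow> nat \<Rightarrow> nat" where
  "perp_count p k = card {y \<in> perp p. card (roots y) = k}"

text \<open>The pairs are ordered, so each chord is counted twice.\<close>

definition secant_count :: "'a ^ 4 \<Rightarrow> nat" where
  "secant_count p = card {(i, j). i \<noteq> j \<and> secant p i j}"

lemma card_nonzero_vectors:
  fixes P :: "'a ^ 4 \<Rightarrow> bool"
  assumes "P 0"
  shows "card {y. y \<noteq> 0 \<and> P y} = card {y. P y} - 1"
proof -
  have "{y. y \<noteq> 0 \<and> P y} = {y. P y} - {0}" by auto
  then show ?thesis using assms by simp
qed

text \<open>Used with \<open>f k\<close> equal to 1, \<open>k\<close> and
  \<open>k * (k - 1)\<close>, it yields the left sides of the three counting equations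
  below.\<close>

lemma sum_perp:
  "(\<Sum>y\<in>perp p. f (card (roots y)))
    = perp_count p 0 * f 0 + perp_count p 1 * f 1 + perp_count p 2 * f 2 + perp_count p 3 * (f 3 :: nat)"
proof -
  have "card (roots y) \<in> {0, 1, 2, 3}" if "y \<in> perp p" for y
  proof -
    have "card (roots y) \<le> 3" using card_roots_le_three[of y] that by (simp add: perp_def)
    then show ?thesis unfolding insert_iff by linarith
  qed
  then have "(\<Sum>y\<in>perp p. f (card (roots y))) = (\<Sum>k\<in>{0,1,2,3}. perp_count p k * f k)"
    using sum_fun_comp[of "perp p" "{0,1,2,3}" "\<lambda>y. card (roots y)" f]
    by (simp add: perp_count_def image_subset_iff)
  then show ?thesis by (simp add: eval_nat_numeral)
qed

lemma perp_count_total: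
  assumes "p \<noteq> 0"
  shows "perp_count p 0 + perp_count p 1 + perp_count p 2 + perp_count p 3 = CARD('a) ^ 3 - 1"
  using sum_perp[of "\<lambda>_. 1" p] card_nonzero_vectors[of "\<lambda>y. sform p y = 0"] card_perp[OF assms]
  by (simp add: perp_def)

text \<open>Double counting of vectors and osculating planes: each of the q + 1 planes meets the
  polar plane of \<open>p\<close> in a line, since \<open>p\<close> is not on the arc.\<close>

lemma perp_count_incidences:
  assumes "p \<noteq> 0" "\<not> on_arc p"
  shows "perp_count p 1 + 2 * perp_count p 2 + 3 * perp_count p 3 = (CARD('a) + 1) * (CARD('a) ^ 2 - 1)"
proof -
  have "card {y \<in> perp p. k \<in> roots y} = CARD('a) ^ 2 - 1" for k
    using card_nonzero_vectors[of "\<lambda>y. sform p y = 0 \<and> k \<in> roots y"] card_perp_w[OF assms, of k]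
    by (simp add: perp_def roots_def)
  then have "(\<Sum>y\<in>perp p. card (roots y)) = (CARD('a) + 1) * (CARD('a) ^ 2 - 1)"
    using sum_card_swap[of "perp p" UNIV "\<lambda>y k. k \<in> roots y"] by simp
  then show ?thesis using sum_perp[of "\<lambda>k. k" p] by simp
qed

text \<open>Double counting of vectors and ordered pairs of osculating planes. A pair contributes
  the q - 1 vectors of one point, plus q^2 - q more when its chord passes through \<open>p\<close>
  and the whole common line is in the polar plane.\<close>

lemma perp_count_pairs:
  "2 * perp_count p 2 + 6 * perp_count p 3
    = (CARD('a) + 1) * CARD('a) * (CARD('a) - 1) + secant_count p * (CARD('a) ^ 2 - CARD('a))"
proof -
  let ?q = "CARD('a)"
  let ?O = "{(i, j). i \<noteq> (j :: 'a option)}" and ?S = "{(i, j). i \<noteq> j \<and> secant p i j}"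
  have q: "?q \<le> ?q ^ 2" "?q \<ge> 1" by (simp_all add: power2_eq_square Suc_leI)
  have cardO: "card ?O = (?q + 1) * ?q" using card_off_diagonal[of "UNIV :: 'a option set"] by simp
  have one: "card {y \<in> perp p. i \<in> roots y \<and> j \<in> roots y}
      = (?q - 1) + (if (i, j) \<in> ?S then ?q ^ 2 - ?q else 0)" if "(i, j) \<in> ?O" for i j
    using card_nonzero_vectors[of "\<lambda>y. sform p y = 0 \<and> i \<in> roots y \<and> j \<in> roots y"]
      card_perp_two_roots[of i j p] that q
    by (simp add: perp_def roots_def)
  have off_diagonal: "{z \<in> ?O. fst z \<in> R \<and> snd z \<in> R} = {(i, j). i \<noteq> j \<and> i \<in> R \<and> j \<in> R}" for R
    by auto
  have "(\<Sum>y\<in>perp p. card (roots y) * (card (roots y) - 1))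
      = (\<Sum>y\<in>perp p. card {z \<in> ?O. fst z \<in> roots y \<and> snd z \<in> roots y})"
    by (simp only: off_diagonal card_off_diagonal[OF finite])
  also have "\<dots> = (\<Sum>z\<in>?O. card {y \<in> perp p. fst z \<in> roots y \<and> snd z \<in> roots y})"
    by (rule sum_card_swap) auto
  also have "\<dots> = (\<Sum>z\<in>?O. (?q - 1) + (if z \<in> ?S then ?q ^ 2 - ?q else 0))"
  proof (rule sum.cong[OF refl])
    fix z assume "z \<in> ?O"
    then show "card {y \<in> perp p. fst z \<in> roots y \<and> snd z \<in> roots y}
        = (?q - 1) + (if z \<in> ?S then ?q ^ 2 - ?q else 0)"
      using one[of "fst z" "snd z"] unfolding prod.collapse by blast
  qed
  also have "\<dots> = card ?O * (?q - 1) + card (?O \<inter> ?S) * (?q ^ 2 - ?q)"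
    by (simp only: sum.distrib sum_constant sum.If_cases[OF finite]) simp
  also have "?O \<inter> ?S = ?S" by auto
  finally show ?thesis
    unfolding cardO sum_perp[of "\<lambda>k. k * (k - 1)" p] secant_count_def by simp
qed


section \<open>Plane sections of the hyperbolic quadric\<close>

lemma scaled_w_inject:
  assumes "c \<noteq> 0" "c' \<noteq> 0" "c *s w i j = c' *s w i' j'"
  shows "c = c' \<and> i = i' \<and> j = j'"
proof -
  \<comment> \<open>The quadric points orthogonal to \<open>w i j\<close> form the cross of the two
    generators through it, and the cross determines its centre.\<close>
  have "sform (c *s w i j) (w k l) = 0 \<longleftrightarrow> k = i \<or> l = j" for k l
    using assms(1) by auto
  moreover have "sform (c' *s w i' j') (w k l) = 0 \<longleftrightarrow> k = i' \<or> l = j'" for k l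
    using assms(2) by auto
  ultimately have *: "k = i \<or> l = j \<longleftrightarrow> k = i' \<or> l = j'" for k l
    using assms(3) by metis
  have "i = i'" "j = j'" using * by (metis option_neq)+
  then show ?thesis using assms(3) by (simp add: vector_mul_rcancel)
qed

text \<open>By \<open>card_roots_eq_two_iff\<close>, exactly two roots characterise the off-diagonal
  points of the quadric.\<close>

lemma perp_count_two:
  "perp_count p 2 = (CARD('a) - 1) * card {(i, j). i \<noteq> j \<and> sform p (w i j) = 0}"
proof -
  let ?Z = "{(i, j). i \<noteq> j \<and> sform p (w i j) = 0}"
  let ?f = "\<lambda>(c, i, j). c *s w i j"
  have "bij_betw ?f ((- {0}) \<times> ?Z) {y \<in> perp p. card (roots y) = 2}"
    unfolding bij_betw_def
  proof
    show "inj_on ?f ((- {0}) \<times> ?Z)"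
    proof (rule inj_onI)
      fix z z' assume z: "z \<in> (- {0}) \<times> ?Z" "z' \<in> (- {0}) \<times> ?Z" "?f z = ?f z'"
      obtain c i j c' i' j' where zz: "z = (c, i, j)" "z' = (c', i', j')"
        by (metis prod_cases3)
      then have "c \<noteq> 0" "c' \<noteq> 0" "c *s w i j = c' *s w i' j'" using z by auto
      then show "z = z'" unfolding zz using scaled_w_inject by blast
    qed
    show "?f ` ((- {0}) \<times> ?Z) = {y \<in> perp p. card (roots y) = 2}"
    proof
      show "?f ` ((- {0}) \<times> ?Z) \<subseteq> {y \<in> perp p. card (roots y) = 2}"
        by (auto simp: perp_def)
      show "{y \<in> perp p. card (roots y) = 2} \<subseteq> ?f ` ((- {0}) \<times> ?Z)"
      proof
        fix y assume y: "y \<in> {y \<in> perp p. card (roots y) = 2}"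
        then obtain c i j where "c \<noteq> 0" "i \<noteq> j" "y = c *s w i j"
          using card_roots_eq_two_iff[of y] by (auto simp: perp_def)
        with y show "y \<in> ?f ` ((- {0}) \<times> ?Z)"
          by (intro image_eqI[of _ _ "(c, i, j)"]) (auto simp: perp_def)
      qed
    qed
  qed
  then have "card ((- {0::'a}) \<times> ?Z) = card {y \<in> perp p. card (roots y) = 2}"
    by (rule bij_betw_same_card)
  then show ?thesis by (simp add: perp_count_def card_cartesian_product Compl_eq_Diff_UNIV)
qed

lemma card_zero_pairs:
  "card {(i, j). sform p (w i j) = 0}
    = card {(i, j). i \<noteq> j \<and> sform p (w i j) = 0} + card (roots p)"
proof -
  have "{(i, j). sform p (w i j) = 0}
      = {(i, j). i \<noteq> j \<and> sform p (w i j) = 0} \<union> (\<lambda>k. (k, k)) ` roots p"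
    by (auto simp: roots_def)
  moreover have "card \<dots> = card {(i, j). i \<noteq> j \<and> sform p (w i j) = 0} + card ((\<lambda>k. (k, k)) ` roots p)"
    by (rule card_Un_disjoint) auto
  moreover have "card ((\<lambda>k. (k, k)) ` roots p) = card (roots p)"
    by (rule card_image) (auto intro: inj_onI)
  ultimately show ?thesis by simp
qed

lemma w_coeffs_unique:
  assumes "i \<noteq> j"
    and eq: "a *s w i i + b *s w i j + c *s w j i + d *s w j j
      = a' *s w i i + b' *s w i j + c' *s w j i + d' *s w j j"
  shows "a = a' \<and> b = b' \<and> c = c' \<and> d = d'"
  using arg_cong[OF eq, of "\<lambda>y. sform y (w j j)"] arg_cong[OF eq, of "\<lambda>y. sform y (w j i)"]
    arg_cong[OF eq, of "\<lambda>y. sform y (w i j)"] arg_cong[OF eq, of "\<lambda>y. sform y (w i i)"] assms(1)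
  by (simp del: \<sigma>_mult)

text \<open>In the basis attached to \<open>i\<close> and \<open>j\<close>, the arc keeps its
  original shape, with parameter \<open>coord i j k\<close> and with \<open>i\<close> as the point
  at infinity.\<close>

lemma w_coord:
  assumes "i \<noteq> j" "k \<noteq> i"
  obtains r where "r \<noteq> 0"
    "w k k = r *s ((coord i j k * \<sigma> (coord i j k)) *s w i i + coord i j k *s w i j
      + \<sigma> (coord i j k) *s w j i + 1 *s w j j)"
proof -
  define x where "x = coord i j k"
  define R where "R = bracket i k * \<sigma> (bracket i k)"
  have br: "bracket k i = bracket i k" "bracket k j = x * bracket i k"
    using assms by (simp_all add: x_def coord_def bracket_commute[of k])
  have "sform (w k k) (w j j) = R * (x * \<sigma> x)" "sform (w k k) (w j i) = R * x"
    "sform (w k k) (w i j) = R * \<sigma> x" "sform (w k k) (w i i) = R"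
    by (simp_all add: br R_def mult_ac)
  then have "w k k = (R / (bracket i j * \<sigma> (bracket i j))) *s ((x * \<sigma> x) *s w i i + x *s w i j
      + \<sigma> x *s w j i + 1 *s w j j)"
    by (subst w_expansion[OF assms(1), of "w k k"])
      (simp add: vector_add_ldistrib vector_smult_assoc)
  then show ?thesis
    using assms by (intro that[of "R / (bracket i j * \<sigma> (bracket i j))"]) (simp_all add: R_def x_def)
qed

lemma roots_singleton_nonzero:
  assumes "roots p = {i}"
  shows "p \<noteq> 0"
proof
  assume "p = 0"
  then have "roots p = UNIV" by (simp add: roots_def)
  with assms show False by (metis UNIV_I option_neq singletonD)
qed

text \<open>With the only root at infinity, any further root would solve
  \<open>a + b * \<sigma> x + c * x = 0\<close>. If just one of \<open>b\<close>, \<open>c\<close>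
  were zero this would be solvable, and if both were, \<open>p\<close> would be on the arc.\<close>

lemma one_rootE:
  assumes "\<not> on_arc p" "roots p = {i}" "i \<noteq> j"
  obtains a b c where "p = a *s w i i + b *s w i j + c *s w j i" "b \<noteq> 0" "c \<noteq> 0"
    "\<forall>x. a + b * \<sigma> x + c * x \<noteq> 0"
proof -
  obtain a b c d where p: "p = a *s w i i + b *s w i j + c *s w j i + d *s w j j"
    and "d = 0 \<longleftrightarrow> sform p (w i i) = 0"
    by (rule w_expansionE[OF assms(3), of p])
  moreover have "sform p (w i i) = 0" using assms(2) by (auto simp: roots_def)
  ultimately have "d = 0" by blast
  with p have p: "p = a *s w i i + b *s w i j + c *s w j i" by simp
  have no_root: "a + b * \<sigma> x + c * x \<noteq> 0" for x
  proof
    assume 0: "a + b * \<sigma> x + c * x = 0"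
    obtain k where k: "k \<noteq> i" "coord i j k = x" using coord_surj[OF assms(3)] .
    obtain r where r: "w k k = r *s ((x * \<sigma> x) *s w i i + x *s w i j + \<sigma> x *s w j i + 1 *s w j j)"
      using w_coord[OF assms(3) k(1)] unfolding k(2) by blast
    have "sform p (w k k) = r * (bracket i j * \<sigma> (bracket i j)) * (a + b * \<sigma> x + c * x)"
      unfolding r p by (simp add: bracket_commute[of j i] algebra_simps)
    then have "k \<in> roots p" using 0 by (simp add: roots_def)
    with k assms(2) show False by simp
  qed
  have "p \<noteq> 0" using roots_singleton_nonzero[OF assms(2)] .
  have "b \<noteq> 0"
  proof
    assume "b = 0"
    have "c = 0"
    proof (rule ccontr)
      assume "c \<noteq> 0"
      then show False using no_root[of "a / c"] \<open>b = 0\<close> by simp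
    qed
    with \<open>b = 0\<close> p have "p = a *s w i i" by simp
    with \<open>p \<noteq> 0\<close> assms(1) show False using on_arcI by blast
  qed
  moreover have "c \<noteq> 0"
  proof
    assume "c = 0"
    obtain x where "\<sigma> x = a / b" using \<sigma>_surj .
    with \<open>b \<noteq> 0\<close> \<open>c = 0\<close> show False using no_root[of x] by simp
  qed
  ultimately show ?thesis using that p no_root by blast
qed

text \<open>Each generator with fixed first index \<open>k\<close> meets the polar plane in exactly
  one point. A generator inside the plane would make \<open>k\<close> a root, hence
  \<open>k = i\<close>, against the nonzero coefficient \<open>c\<close> of \<open>w j i\<close> in
  \<open>p\<close>.\<close>

lemma card_zero_pairs_one_root:
  assumes "\<not> on_arc p" "card (roots p) = 1"
  shows "card {(i, j). sform p (w i j) = 0} = CARD('a) + 1"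
proof -
  obtain i where i: "roots p = {i}" using assms(2) by (auto simp: card_1_singleton_iff)
  have "card {l. sform p (w k l) = 0} = 1" for k
  proof -
    define \<alpha> where "\<alpha> = p $ 1 * hi k + p $ 2 * lo k"
    define \<beta> where "\<beta> = p $ 3 * hi k + p $ 4 * lo k"
    have form: "sform p (w k l) = \<alpha> * \<sigma> (hi l) + \<beta> * \<sigma> (lo l)" for l
      by (simp add: sform_def w_def vector_4 \<alpha>_def \<beta>_def algebra_simps)
    have "\<not> (\<alpha> = 0 \<and> \<beta> = 0)"
    proof
      assume 0: "\<alpha> = 0 \<and> \<beta> = 0"
      then have "k \<in> roots p" by (simp add: roots_def form)
      then have "k = i" using i by simp
      obtain j where "j \<noteq> i" using option_neq .
      obtain a b c where "p = a *s w i i + b *s w i j + c *s w j i" "c \<noteq> 0"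
        using one_rootE[OF assms(1) i \<open>j \<noteq> i\<close>[symmetric]] .
      then have "sform p (w i j) \<noteq> 0" using \<open>j \<noteq> i\<close> by simp
      with 0 form \<open>k = i\<close> show False by simp
    qed
    obtain l0 where "{l. sform p (w k l) = 0} = {l0}"
    proof (cases "\<alpha> = 0")
      case True
      then have "sform p (w k l) = 0 \<longleftrightarrow> l = None" for l
        using \<open>\<not> (\<alpha> = 0 \<and> \<beta> = 0)\<close> by (auto simp: form lo_def split: option.splits)
      then show ?thesis using that[of None] by auto
    next
      case False
      obtain s where "\<sigma> s = \<beta> / \<alpha>" using \<sigma>_surj .
      then have s: "\<beta> = \<alpha> * \<sigma> s" using False by simp
      have "sform p (w k l) = 0 \<longleftrightarrow> l = Some s" for l
        using False by (cases l) (auto simp: form lo_def hi_def s)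
      then show ?thesis using that[of "Some s"] by auto
    qed
    then show ?thesis by simp
  qed
  moreover have "{(k, l). sform p (w k l) = 0} = (SIGMA k:UNIV. {l. sform p (w k l) = 0})" by auto
  ultimately show ?thesis by simp
qed

text \<open>The polar plane of a quadric point is the tangent plane, which cuts out the two
  generators through it.\<close>

lemma card_zero_pairs_two_roots:
  assumes "c \<noteq> 0"
  shows "card {(k, l). sform (c *s w i j) (w k l) = 0} = 2 * CARD('a) + 1"
proof -
  have "{(k, l). sform (c *s w i j) (w k l) = 0} = {i} \<times> UNIV \<union> (- {i}) \<times> {j}"
    using assms by auto
  moreover have "card ({i} \<times> (UNIV :: 'a option set) \<union> (- {i}) \<times> {j}) = 2 * CARD('a) + 1"
    by (subst card_Un_disjoint) (auto simp: card_cartesian_product Compl_eq_Diff_UNIV)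
  ultimately show ?thesis by simp
qed

section \<open>Chords of the arc\<close>

text \<open>The quadratic form of the quadric restricts to a nonzero multiple of
  \<open>a * b\<close> on a chord, so a chord meets the quadric only in its two endpoints, which are
  arc points.\<close>

lemma secant_count_two_roots:
  assumes "c \<noteq> 0" "i \<noteq> j"
  shows "secant_count (c *s w i j) = 0"
proof -
  define det where "det y = y $ 1 * y $ 4 + y $ 2 * y $ 3" for y :: "'a ^ 4"
  have "\<not> secant (c *s w i j) k l" if "k \<noteq> l" for k l
  proof
    assume "secant (c *s w i j) k l"
    then obtain a b where eq: "c *s w i j = a *s w k k + b *s w l l" by (auto simp: secant_def)
    have "det (c *s w i j) = 0"
      by (simp add: det_def w_def vector_4 algebra_simps)
    moreover have "det (a *s w k k + b *s w l l) = a * b * (bracket k l * \<sigma> (bracket k l))"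
      by (simp add: det_def w_def vector_4 bracket_def algebra_simps)
    ultimately have "a = 0 \<or> b = 0" using eq that by simp
    then obtain d m where "c *s w i j = d *s w m m" using eq by auto
    moreover from this assms have "d \<noteq> 0" by auto
    ultimately show False using assms scaled_w_inject by blast
  qed
  then have "{(k, l). k \<noteq> l \<and> secant (c *s w i j) k l} = {}" by auto
  then show ?thesis by (simp add: secant_count_def)
qed

text \<open>In coordinates, a chord through \<open>p\<close> joins \<open>x\<close> and \<open>x + \<delta>\<close> for a fixed \<open>\<delta>\<close>, and
  rescaling by \<open>\<delta>\<close> turns the condition on \<open>x\<close> into an Artin--Schreier type equation.\<close>

lemma secant_count_one_root:
  assumes "\<not> on_arc p" "card (roots p) = 1"
  shows "secant_count p = (if \<exists>z. \<sigma> z + z = 1 then 0 else 2)"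
proof -
  obtain i where i: "roots p = {i}" using assms(2) by (auto simp: card_1_singleton_iff)
  obtain j where "j \<noteq> i" using option_neq .
  then have "i \<noteq> j" by simp
  obtain a b c where p: "p = a *s w i i + b *s w i j + c *s w j i" and "b \<noteq> 0" "c \<noteq> 0"
    and no_root: "\<forall>x. a + b * \<sigma> x + c * x \<noteq> 0"
    by (rule one_rootE[OF assms(1) i \<open>i \<noteq> j\<close>])
  \<comment> \<open>This \<delta> is chosen so that \<open>x = \<delta> * z\<close> turns
    \<open>b * \<sigma> x + c * x\<close> into
    \<open>b * \<sigma> \<delta> * (\<sigma> z + z)\<close>; then \<open>e\<close> is the rescaled
    \<open>a\<close>, and \<open>no_root\<close> says that \<open>\<sigma> z + z\<close> never
    equals \<open>e\<close>.\<close>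
  obtain \<delta> where "\<delta> \<noteq> 0" and \<delta>': "\<sigma> \<delta> = c / b * \<delta>"
    using \<sigma>_quotient_exists[of "c / b"] \<open>b \<noteq> 0\<close> \<open>c \<noteq> 0\<close> by auto
  then have \<delta>: "b * \<sigma> \<delta> = c * \<delta>" using \<open>b \<noteq> 0\<close> by simp
  define e where "e = a / (b * \<sigma> \<delta>)"
  have a_eq: "a = b * \<sigma> \<delta> * e" using \<open>b \<noteq> 0\<close> \<open>\<delta> \<noteq> 0\<close> by (simp add: e_def)
  have "\<sigma> z + z \<noteq> e" for z
  proof
    assume "\<sigma> z + z = e"
    then have "a = b * \<sigma> \<delta> * \<sigma> z + c * \<delta> * z"
      using \<delta> a_eq by (metis distrib_left)
    then show False using no_root[rule_format, of "\<delta> * z"] by (simp add: algebra_simps)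
  qed
  note card_Z = card_shifted_fixed_points[OF this]

  let ?x = "coord i j"
  \<comment> \<open>The chord condition in coordinates. The coefficient of \<open>w j j\<close> in
    \<open>p\<close> is zero, which forces equal weights \<open>t\<close> on the two
    endpoints.\<close>
  define Q where "Q x x' \<longleftrightarrow>
    (\<exists>t. b = t * (x + x') \<and> c = t * (\<sigma> x + \<sigma> x') \<and> a = t * (x * \<sigma> x + x' * \<sigma> x'))" for x x'
  \<comment> \<open>If \<open>w i i\<close> were an endpoint, \<open>p\<close> being on the
    osculating plane at \<open>i\<close> would annihilate the other summand and put \<open>p\<close>
    on the arc.\<close>
  have not_i: "k \<noteq> i" "l \<noteq> i" if "secant p k l" "k \<noteq> l" for k l
  proof -
    have *: False if "p = s *s w i i + t *s w m m" "m \<noteq> i" for s t m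
    proof -
      have "sform p (w i i) = 0" using i by (auto simp: roots_def)
      then have "t = 0" using that by simp
      with that have "p = s *s w i i" by simp
      then show False using on_arcI assms(1) roots_singleton_nonzero[OF i] by blast
    qed
    obtain s t where "p = s *s w k k + t *s w l l" using \<open>secant p k l\<close> by (auto simp: secant_def)
    then show "k \<noteq> i" "l \<noteq> i" using *[of s t l] *[of t s k] \<open>k \<noteq> l\<close> by (auto simp: add.commute)
  qed
  have secant_iff: "secant p k l \<longleftrightarrow> Q (?x k) (?x l)" if "k \<noteq> i" "l \<noteq> i" for k l
  proof -
    let ?u = "\<lambda>x. (x * \<sigma> x) *s w i i + x *s w i j + \<sigma> x *s w j i + 1 *s w j j"
    obtain r where r: "r \<noteq> 0" "w k k = r *s ?u (?x k)" using w_coord[OF \<open>i \<noteq> j\<close> \<open>k \<noteq> i\<close>] .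
    obtain r' where r': "r' \<noteq> 0" "w l l = r' *s ?u (?x l)" using w_coord[OF \<open>i \<noteq> j\<close> \<open>l \<noteq> i\<close>] .
    have comb: "s *s ?u x + t *s ?u x' = (s * (x * \<sigma> x) + t * (x' * \<sigma> x')) *s w i i
        + (s * x + t * x') *s w i j + (s * \<sigma> x + t * \<sigma> x') *s w j i + (s + t) *s w j j" for s t x x'
      by (simp add: vec4_eq_iff algebra_simps)
    have p': "p = a *s w i i + b *s w i j + c *s w j i + 0 *s w j j" using p by simp
    show ?thesis
    proof
      assume "secant p k l"
      then obtain s t where "p = s *s w k k + t *s w l l" by (auto simp: secant_def)
      then have "p = (s * r) *s ?u (?x k) + (t * r') *s ?u (?x l)"
        unfolding r(2) r'(2) by (simp only: vector_smult_assoc)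
      then have *: "a = s * r * (?x k * \<sigma> (?x k)) + t * r' * (?x l * \<sigma> (?x l)) \<and> b = s * r * ?x k + t * r' * ?x l
          \<and> c = s * r * \<sigma> (?x k) + t * r' * \<sigma> (?x l) \<and> 0 = s * r + t * r'"
        unfolding comb p' by (intro w_coeffs_unique[OF \<open>i \<noteq> j\<close>])
      then have "s * r = t * r'" by (metis add_eq_0_iff_eq)
      with * have "b = s * r * (?x k + ?x l) \<and> c = s * r * (\<sigma> (?x k) + \<sigma> (?x l))
          \<and> a = s * r * (?x k * \<sigma> (?x k) + ?x l * \<sigma> (?x l))"
        by (simp add: distrib_left)
      then show "Q (?x k) (?x l)" unfolding Q_def by blast
    next
      assume "Q (?x k) (?x l)"
      then obtain t where "b = t * (?x k + ?x l) \<and> c = t * (\<sigma> (?x k) + \<sigma> (?x l))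
          \<and> a = t * (?x k * \<sigma> (?x k) + ?x l * \<sigma> (?x l))" unfolding Q_def by blast
      then have "p = t *s ?u (?x k) + t *s ?u (?x l)"
        unfolding comb p by (simp add: distrib_left)
      also have "\<dots> = (t / r) *s w k k + (t / r') *s w l l"
        unfolding r(2) r'(2) vector_smult_assoc using r(1) r'(1) by simp
      finally show "secant p k l" unfolding secant_def by blast
    qed
  qed
  have bij: "bij_betw ?x (- {i}) UNIV" by (rule coord_bij[OF \<open>i \<noteq> j\<close>])
  have "bij_betw (map_prod ?x ?x) {(k, l). k \<noteq> l \<and> secant p k l} {(x, x'). x \<noteq> x' \<and> Q x x'}"
    unfolding bij_betw_def
  proof
    have inj: "?x k = ?x l \<longleftrightarrow> k = l" if "k \<noteq> i" "l \<noteq> i" for k l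
      using bij that by (auto simp: bij_betw_def inj_on_def)
    show "inj_on (map_prod ?x ?x) {(k, l). k \<noteq> l \<and> secant p k l}"
    proof (rule inj_onI)
      fix z z' assume z: "z \<in> {(k, l). k \<noteq> l \<and> secant p k l}" "z' \<in> {(k, l). k \<noteq> l \<and> secant p k l}"
        "map_prod ?x ?x z = map_prod ?x ?x z'"
      then have "fst z \<noteq> i" "snd z \<noteq> i" "fst z' \<noteq> i" "snd z' \<noteq> i"
        using not_i[of "fst z" "snd z"] not_i[of "fst z'" "snd z'"] by (simp_all add: case_prod_beta)
      with z(3) show "z = z'" by (cases z; cases z') (simp add: inj)
    qed
    show "map_prod ?x ?x ` {(k, l). k \<noteq> l \<and> secant p k l} = {(x, x'). x \<noteq> x' \<and> Q x x'}"
    proof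
      show "map_prod ?x ?x ` {(k, l). k \<noteq> l \<and> secant p k l} \<subseteq> {(x, x'). x \<noteq> x' \<and> Q x x'}"
      proof (rule image_subsetI)
        fix z assume z: "z \<in> {(k, l). k \<noteq> l \<and> secant p k l}"
        then have "fst z \<noteq> i" "snd z \<noteq> i"
          using not_i[of "fst z" "snd z"] by (simp_all add: case_prod_beta)
        then show "map_prod ?x ?x z \<in> {(x, x'). x \<noteq> x' \<and> Q x x'}"
          using z by (cases z) (simp add: inj secant_iff)
      qed
      show "{(x, x'). x \<noteq> x' \<and> Q x x'} \<subseteq> map_prod ?x ?x ` {(k, l). k \<noteq> l \<and> secant p k l}"
      proof clarify
        fix x x' assume "x \<noteq> x'" "Q x x'"
        obtain k l where "k \<noteq> i" "?x k = x" "l \<noteq> i" "?x l = x'"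
          using coord_surj[OF \<open>i \<noteq> j\<close>] by metis
        then show "(x, x') \<in> map_prod ?x ?x ` {(k, l). k \<noteq> l \<and> secant p k l}"
          using \<open>x \<noteq> x'\<close> \<open>Q x x'\<close> secant_iff by (intro image_eqI[of _ _ "(k, l)"]) auto
      qed
    qed
  qed
  then have "secant_count p = card {(x, x'). x \<noteq> x' \<and> Q x x'}"
    unfolding secant_count_def by (rule bij_betw_same_card)
  also have "{(x, x'). x \<noteq> x' \<and> Q x x'} = (\<lambda>z. (\<delta> * z, \<delta> * z + \<delta>)) ` {z. \<sigma> z + z = e + 1}"
  proof (intro equalityI subsetI; clarify)
    fix x x' assume "x \<noteq> x'" "Q x x'"
    then obtain t where t: "b = t * (x + x')" "c = t * (\<sigma> x + \<sigma> x')" "a = t * (x * \<sigma> x + x' * \<sigma> x')"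
      unfolding Q_def by blast
    \<comment> \<open>The equations for \<open>b\<close> and \<open>c\<close> give
      \<open>x + x'\<close> and \<delta> the same quotient under \<open>y -> \<sigma> y / y\<close>,
      which is injective.\<close>
    have "x + x' = \<delta>"
    proof (rule \<sigma>_quotient_unique)
      show "\<sigma> (x + x') * \<delta> = \<sigma> \<delta> * (x + x')"
      proof -
        have "t \<noteq> 0" using t(1) \<open>b \<noteq> 0\<close> by auto
        have "t * (\<sigma> (x + x') * \<delta>) = t * (\<sigma> \<delta> * (x + x'))"
          using \<delta> unfolding t(1,2) \<sigma>_add by (simp only: mult_ac)
        then show ?thesis using mult_left_cancel[OF \<open>t \<noteq> 0\<close>] by blast
      qed
    qed (use \<open>x \<noteq> x'\<close> \<open>\<delta> \<noteq> 0\<close> in auto)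
    then have x': "x' = x + \<delta>" by (metis add_self_left)
    define z where "z = x / \<delta>"
    have x: "x = \<delta> * z" using \<open>\<delta> \<noteq> 0\<close> by (simp add: z_def)
    have "b * \<sigma> \<delta> * e = b * \<sigma> \<delta> * (\<sigma> z + z + 1)"
      unfolding a_eq[symmetric] t(3) using t(1) by (simp add: x' x algebra_simps)
    then have "e = \<sigma> z + z + 1" using \<open>b \<noteq> 0\<close> \<open>\<delta> \<noteq> 0\<close> by simp
    then have "\<sigma> z + z = e + 1" by (simp add: add.assoc)
    then show "(x, x') \<in> (\<lambda>z. (\<delta> * z, \<delta> * z + \<delta>)) ` {z. \<sigma> z + z = e + 1}"
      by (auto simp: x x')
  next
    fix z assume z: "\<sigma> z + z = e + 1"
    show "\<delta> * z \<noteq> \<delta> * z + \<delta> \<and> Q (\<delta> * z) (\<delta> * z + \<delta>)"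
    proof
      have "e = (\<sigma> z + z) + 1" by (simp add: z add.assoc)
      then have "a = b * \<sigma> \<delta> * (\<sigma> z + z + 1)" using a_eq by simp
      then have "a = b / \<delta> * (\<delta> * z * \<sigma> (\<delta> * z) + (\<delta> * z + \<delta>) * \<sigma> (\<delta> * z + \<delta>))"
        using \<open>\<delta> \<noteq> 0\<close> by (simp add: algebra_simps)
      moreover have "b = b / \<delta> * (\<delta> * z + (\<delta> * z + \<delta>))" "c = b / \<delta> * (\<sigma> (\<delta> * z) + \<sigma> (\<delta> * z + \<delta>))"
        using \<open>\<delta> \<noteq> 0\<close> \<delta> by (simp_all add: field_simps)
      ultimately show "Q (\<delta> * z) (\<delta> * z + \<delta>)" unfolding Q_def by blast
    qed (use \<open>\<delta> \<noteq> 0\<close> in simp)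
  qed
  also have "card \<dots> = card {z. \<sigma> z + z = e + 1}"
    using \<open>\<delta> \<noteq> 0\<close> by (intro card_image inj_onI) simp
  finally show ?thesis using card_Z by simp
qed

end

section \<open>Points and planes of PG(3,q)\<close>

lemma mem_span_singleton: "x \<in> vec.span {y} \<longleftrightarrow> (\<exists>c. x = c *s y)"
  by (auto simp: vec.span_singleton)

lemma span_singleton_eq_iff:
  fixes x y :: "'a::field ^ 'n"
  assumes "x \<noteq> 0"
  shows "vec.span {x} = vec.span {y} \<longleftrightarrow> (\<exists>c. c \<noteq> 0 \<and> x = c *s y)"
proof
  assume "vec.span {x} = vec.span {y}"
  then have "x \<in> vec.span {y}" using vec.span_base[of x "{x}"] by simp
  then show "\<exists>c. c \<noteq> 0 \<and> x = c *s y" using assms by (auto simp: mem_span_singleton)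
next
  assume "\<exists>c. c \<noteq> 0 \<and> x = c *s y"
  then obtain c where c: "c \<noteq> 0" "x = c *s y" by blast
  then have "y = (1 / c) *s x" by (simp add: vector_smult_assoc)
  then have "y \<in> vec.span {x}" using mem_span_singleton by blast
  moreover have "x \<in> vec.span {y}" using c mem_span_singleton by blast
  ultimately show "vec.span {x} = vec.span {y}" by (simp add: vec.span_eq)
qed

lemma pg_points_eq: "pg_points = (\<lambda>y. vec.span {y}) ` {y. y \<noteq> 0}"
proof (intro equalityI subsetI)
  fix W :: "('a ^ 4) set" assume "W \<in> pg_points"
  then have W: "vec.subspace W" "vec.dim W = 1" by (auto simp: pg_points_def)
  obtain B where B: "B \<subseteq> W" "vec.independent B" "W \<subseteq> vec.span B" "card B = vec.dim W"
    using vec.basis_exists by blast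
  then obtain y where y: "B = {y}" using W(2) by (auto simp: card_1_singleton_iff)
  then have "y \<noteq> 0" using B(2) by auto
  moreover have "W = vec.span {y}" using B y W(1) vec.span_minimal by blast
  ultimately show "W \<in> (\<lambda>y. vec.span {y}) ` {y. y \<noteq> 0}" by blast
qed (auto simp: pg_points_def)

lemma polar_span: "polar (vec.span {y}) = {z. sform y z = 0}"
proof (intro equalityI subsetI)
  fix z assume "z \<in> polar (vec.span {y})"
  then show "z \<in> {z. sform y z = 0}" using vec.span_base[of y "{y}"] by (simp add: polar_def)
qed (auto simp: polar_def mem_span_singleton)

lemma span_subset_polar_span: "vec.span {p} \<subseteq> polar (vec.span {y}) \<longleftrightarrow> sform p y = 0"
proof
  assume "vec.span {p} \<subseteq> polar (vec.span {y})"
  then have "p \<in> polar (vec.span {y})" using vec.span_base[of p "{p}"] by auto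
  then show "sform p y = 0" by (simp add: polar_span sform_commute)
qed (auto simp: polar_span mem_span_singleton sform_commute[of y])

text \<open>Two nonzero linear forms with the same kernel are proportional. This lets planes be
  counted through their poles.\<close>

lemma polar_inj_on_points: "inj_on polar (pg_points :: ('a::field ^ 4) set set)"
proof (rule inj_onI)
  fix P Q :: "('a ^ 4) set"
  assume "P \<in> pg_points" "Q \<in> pg_points" and eq: "polar P = polar Q"
  then obtain x y where x: "x \<noteq> 0" "P = vec.span {x}" and y: "y \<noteq> 0" "Q = vec.span {y}"
    by (auto simp: pg_points_eq)
  have iff: "sform x z = 0 \<longleftrightarrow> sform y z = 0" for z
    using eq by (auto simp: x y polar_span)
  obtain z0 where z0: "sform x z0 \<noteq> 0" using sform_nondegenerate x(1) by blast
  define c where "c = sform y z0 / sform x z0"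
  have "sform (y - c *s x) z = 0" for z
  proof -
    have "sform x (z - (sform x z / sform x z0) *s z0) = 0" using z0 by simp
    then have "sform y (z - (sform x z / sform x z0) *s z0) = 0" using iff by blast
    then show ?thesis by (simp add: sform_commute[of _ z] c_def field_simps)
  qed
  then have "y - c *s x = 0" by (rule sform_nondegenerate)
  then have "y = c *s x" by simp
  moreover from this y(1) have "c \<noteq> 0" by auto
  ultimately show "P = Q" using span_singleton_eq_iff[OF y(1)] x(2) y(2) by blast
qed

lemma card_spanned_points:
  fixes Y :: "('a::{field,finite} ^ 'n::finite) set"
  assumes "0 \<notin> Y" and closed: "\<And>c y. c \<noteq> 0 \<Longrightarrow> y \<in> Y \<Longrightarrow> c *s y \<in> Y"
  shows "card Y = (CARD('a) - 1) * card ((\<lambda>y. vec.span {y}) ` Y)"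
proof -
  have fibre: "card {x \<in> Y. vec.span {x} = vec.span {y}} = CARD('a) - 1" if "y \<in> Y" for y
  proof -
    have "{x \<in> Y. vec.span {x} = vec.span {y}} = (\<lambda>c. c *s y) ` (- {0})"
    proof (intro equalityI subsetI)
      fix x assume x: "x \<in> {x \<in> Y. vec.span {x} = vec.span {y}}"
      then have "x \<noteq> 0" using assms(1) by auto
      then show "x \<in> (\<lambda>c. c *s y) ` (- {0})" using x span_singleton_eq_iff by blast
    next
      fix x assume "x \<in> (\<lambda>c. c *s y) ` (- {0})"
      then obtain c where c: "c \<noteq> 0" "x = c *s y" by auto
      then have "x \<in> Y" using closed that by simp
      moreover from this have "x \<noteq> 0" using assms(1) by auto
      ultimately show "x \<in> {x \<in> Y. vec.span {x} = vec.span {y}}"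
        using span_singleton_eq_iff c by blast
    qed
    moreover have "inj_on (\<lambda>c. c *s y) (- {0})"
      using that assms(1) by (auto intro!: inj_onI simp: vector_mul_rcancel)
    ultimately show ?thesis by (simp add: card_image Compl_eq_Diff_UNIV)
  qed
  have "card Y = (\<Sum>P\<in>(\<lambda>y. vec.span {y}) ` Y. card {x \<in> Y. vec.span {x} = P})"
    using sum.group[of Y "(\<lambda>y. vec.span {y}) ` Y" "\<lambda>y. vec.span {y}" "\<lambda>_. 1::nat"] by simp
  also have "\<dots> = (\<Sum>P\<in>(\<lambda>y. vec.span {y}) ` Y. CARD('a) - 1)"
    using fibre by (intro sum.cong) auto
  finally show ?thesis by simp
qed

context frobenius_arc
begin

lemma card_roots_on_arc: "on_arc y \<Longrightarrow> card (roots y) = 1"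
  by (auto simp: on_arc_def)

text \<open>By symmetry of the form, an arc point is in the polar plane of \<open>p\<close> exactly
  when \<open>p\<close> is on the osculating plane at that arc point.\<close>

lemma card_perp_on_arc: "card {y \<in> perp p. on_arc y} = (CARD('a) - 1) * card (roots p)"
proof -
  have "bij_betw (\<lambda>(c, k). c *s w k k) ((- {0}) \<times> roots p) {y \<in> perp p. on_arc y}"
    unfolding bij_betw_def
  proof
    show "inj_on (\<lambda>(c, k). c *s w k k) ((- {0}) \<times> roots p)"
    proof (rule inj_onI)
      fix z z' assume "z \<in> (- {0}) \<times> roots p" "z' \<in> (- {0}) \<times> roots p"
        "(\<lambda>(c, k). c *s w k k) z = (\<lambda>(c, k). c *s w k k) z'"
      then show "z = z'" using scaled_w_inject by (cases z; cases z') auto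
    qed
    show "(\<lambda>(c, k). c *s w k k) ` ((- {0}) \<times> roots p) = {y \<in> perp p. on_arc y}"
      by (force simp: perp_def on_arc_def roots_def)
  qed
  then have "card ((- {0::'a}) \<times> roots p) = card {y \<in> perp p. on_arc y}"
    by (rule bij_betw_same_card)
  then show ?thesis by (simp add: card_cartesian_product Compl_eq_Diff_UNIV)
qed

end

section \<open>From vector counts to the point and plane classes\<close>

locale frobenius_power_arc = frobenius_arc \<sigma> for \<sigma> :: "'a::{field,finite} \<Rightarrow> 'a" +
  fixes h :: nat
  assumes \<sigma>_eq: "\<sigma> x = x ^ (2 ^ h)"
begin

lemma arc_eq: "arc h = range (\<lambda>k. vec.span {w k k})"
proof -
  have "proj_point 1 t (t ^ (2 ^ h)) (t ^ (2 ^ h + 1)) = vec.span {w (Some t) (Some t)}" for t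
    by (simp add: proj_point_def w_def lo_def hi_def \<sigma>_eq)
  moreover have "proj_point 0 0 0 1 = vec.span {w None None}"
    by (simp add: proj_point_def w_def lo_def hi_def)
  ultimately show ?thesis
    unfolding arc_def by (auto simp: UNIV_option_conv)
qed

lemma span_in_arc_iff:
  assumes "y \<noteq> 0"
  shows "vec.span {y} \<in> arc h \<longleftrightarrow> on_arc y"
proof -
  have "vec.span {y} \<in> arc h \<longleftrightarrow> (\<exists>k. vec.span {y} = vec.span {w k k})" by (auto simp: arc_eq)
  then show ?thesis unfolding span_singleton_eq_iff[OF assms] on_arc_def by blast
qed

lemma card_osculating_planes_through:
  "card {\<pi> \<in> osculating_planes h. vec.span {p} \<subseteq> \<pi>} = card (roots p)"
proof -
  have "{\<pi> \<in> osculating_planes h. vec.span {p} \<subseteq> \<pi>} = (\<lambda>k. polar (vec.span {w k k})) ` roots p"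
    unfolding osculating_planes_def arc_eq roots_def
    using span_subset_polar_span[of p] by blast
  moreover have "inj_on (\<lambda>k. polar (vec.span {w k k})) (roots p)"
  proof (rule inj_onI)
    fix k l assume "polar (vec.span {w k k}) = polar (vec.span {w l l})"
    then have "vec.span {w k k} = vec.span {w l l}"
      by (rule inj_onD[OF polar_inj_on_points]) (auto simp: pg_points_eq)
    then obtain c where "c \<noteq> 0" "1 *s w k k = c *s w l l"
      using span_singleton_eq_iff[of "w k k" "w l l"] by auto
    then show "k = l" using scaled_w_inject[of 1 c k k l l] by simp
  qed
  ultimately show ?thesis by (simp add: card_image)
qed

lemma point_class_eq:
  assumes "d \<noteq> CARD('a) + 1"
  shows "(point_class h d :: ('a ^ 4) set set) = (\<lambda>y. vec.span {y}) ` {y. y \<noteq> 0 \<and> \<not> on_arc y \<and> card (roots y) = d}"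
proof -
  have "(point_class h d :: ('a ^ 4) set set) = {P \<in> pg_points - arc h. card {\<pi> \<in> osculating_planes h. P \<subseteq> \<pi>} = d}"
    using assms by (simp add: point_class_def)
  then show ?thesis
    by (auto simp: pg_points_eq span_in_arc_iff card_osculating_planes_through)
qed

text \<open>A polar plane passes through a point exactly when its pole lies in the polar plane of
  that point.\<close>

lemma card_planes_through:
  assumes "d \<noteq> CARD('a) + 1"
  shows "(CARD('a) - 1) * card {\<pi> \<in> plane_class h d. vec.span {p} \<subseteq> \<pi>}
    = card {y \<in> perp p. \<not> on_arc y \<and> card (roots y) = d}"
proof -
  let ?Y = "{y \<in> perp p. \<not> on_arc y \<and> card (roots y) = d}"
  have "{\<pi> \<in> plane_class h d. vec.span {p} \<subseteq> \<pi>} = polar ` (\<lambda>y. vec.span {y}) ` ?Y"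
    unfolding plane_class_def point_class_eq[OF assms] perp_def
    using span_subset_polar_span[of p] by blast
  moreover have "inj_on polar ((\<lambda>y. vec.span {y}) ` ?Y)"
    by (rule inj_on_subset[OF polar_inj_on_points]) (auto simp: pg_points_eq perp_def)
  ultimately have "card {\<pi> \<in> plane_class h d. vec.span {p} \<subseteq> \<pi>} = card ((\<lambda>y. vec.span {y}) ` ?Y)"
    by (simp add: card_image)
  moreover have "card ?Y = (CARD('a) - 1) * card ((\<lambda>y. vec.span {y}) ` ?Y)"
  proof (rule card_spanned_points)
    have "on_arc (c *s y) \<longleftrightarrow> on_arc y" if "c \<noteq> 0" for c y
    proof
      assume "on_arc (c *s y)"
      then obtain b k where "b \<noteq> 0" "c *s y = b *s w k k" by (auto simp: on_arc_def)
      then have "y = (b / c) *s w k k"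
        using that by (metis (no_types, lifting) divide_self mult.commute times_divide_eq_right
            mult_1_right vector_smult_assoc vector_smult_lid divide_inverse)
      with \<open>b \<noteq> 0\<close> that show "on_arc y" unfolding on_arc_def by (intro exI[of _ "b / c"]) auto
    next
      assume "on_arc y"
      then obtain b k where "b \<noteq> 0" "y = b *s w k k" by (auto simp: on_arc_def)
      with that show "on_arc (c *s y)"
        unfolding on_arc_def by (intro exI[of _ "c * b"]) (auto simp: vector_smult_assoc)
    qed
    then show "c *s y \<in> ?Y" if "c \<noteq> 0" "y \<in> ?Y" for c y
      using that by (simp add: perp_def)
  qed (simp add: perp_def)
  ultimately show ?thesis by simp
qed

text \<open>Arc points have one root but are excluded from the class with index 1, hence the
  correction term at \<open>d = 1\<close>.\<close>

lemma perp_count_eq: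
  assumes "d \<noteq> CARD('a) + 1"
  shows "perp_count p d = (CARD('a) - 1) *
    (card {\<pi> \<in> plane_class h d. vec.span {p} \<subseteq> \<pi>} + (if d = 1 then card (roots p) else 0))"
proof -
  have "{y \<in> perp p. card (roots y) = d} = {y \<in> perp p. \<not> on_arc y \<and> card (roots y) = d}
      \<union> {y \<in> perp p. on_arc y \<and> d = 1}"
    using card_roots_on_arc by auto
  moreover have "card \<dots> = card {y \<in> perp p. \<not> on_arc y \<and> card (roots y) = d}
      + card {y \<in> perp p. on_arc y \<and> d = 1}"
    by (rule card_Un_disjoint) auto
  moreover have "card {y \<in> perp p. on_arc y \<and> d = 1}
      = (if d = 1 then (CARD('a) - 1) * card (roots p) else 0)"
    using card_perp_on_arc by simp
  ultimately show ?thesis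
    unfolding perp_count_def using card_planes_through[OF assms, of p] by (simp add: distrib_left)
qed

text \<open>The quadric section gives \<open>r 2\<close>; then the equations for pairs, incidences
  and totals give \<open>r 3\<close>, \<open>r 1\<close> and \<open>r 0\<close> in turn. The
  parameters are the roots \<open>m\<close>, the ordered chords \<open>s\<close> and the quadric
  points \<open>t\<close> in the polar plane.\<close>

lemma plane_counts:
  fixes p :: "'a ^ 4"
  assumes "CARD('a) \<ge> 3" "p \<noteq> 0" "\<not> on_arc p"
  defines "r \<equiv> \<lambda>d. of_nat (card {\<pi> \<in> plane_class h d. vec.span {p} \<subseteq> \<pi>}) :: rat"
    and "q \<equiv> of_nat CARD('a)" and "m \<equiv> of_nat (card (roots p))" and "s \<equiv> of_nat (secant_count p)"
    and "t \<equiv> of_nat (card {(i, j). sform p (w i j) = 0})"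
  shows "r (CARD('a) + 1) = m" and "r 2 = t - m" and "r 3 = (q * (q + 1) + s * q - 2 * (t - m)) / 6"
    and "r 1 = (q + 1)\<^sup>2 - m - 2 * (t - m) - (q * (q + 1) + s * q - 2 * (t - m)) / 2"
    and "r 0 = (t - m) - q + (q * (q + 1) + s * q - 2 * (t - m)) / 3"
proof -
  have q: "q - 1 \<noteq> 0" using assms(1) by (simp add: q_def)
  have sub: "of_nat (CARD('a) - 1) = q - 1" "of_nat (CARD('a) ^ 2 - 1) = (q - 1) * (q + 1)"
    "of_nat (CARD('a) ^ 2 - CARD('a)) = (q - 1) * q" "of_nat (CARD('a) ^ 3 - 1) = (q - 1) * (q ^ 2 + q + 1)"
    using assms(1) by (simp_all add: of_nat_diff q_def algebra_simps power2_eq_square power3_eq_cube)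
  have M: "of_nat (perp_count p d) = (q - 1) * (r d + (if d = 1 then m else 0))" if "d \<le> 3" for d
  proof -
    \<comment> \<open>The bound on q keeps 0, 1, 2, 3 apart from the index reserved for the
      arc.\<close>
    have "d \<noteq> CARD('a) + 1" using that assms(1) by simp
    then show ?thesis
      unfolding perp_count_eq[OF \<open>d \<noteq> _\<close>] of_nat_mult of_nat_add sub by (simp add: r_def m_def)
  qed
  show "r (CARD('a) + 1) = m"
    using card_osculating_planes_through[of p]
    by (simp add: r_def m_def plane_class_def point_class_def osculating_planes_def)
  have "of_nat (perp_count p 2) = (q - 1) * (t - m)"
    unfolding perp_count_two of_nat_mult sub t_def m_def card_zero_pairs by simp
  then show r2: "r 2 = t - m" using M[of 2] q by simp
  have "2 * of_nat (perp_count p 2) + 6 * of_nat (perp_count p 3)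
      = (q + 1) * q * (q - 1) + s * ((q - 1) * q)"
    using arg_cong[OF perp_count_pairs[of p], of "of_nat :: nat \<Rightarrow> rat"]
    by (simp only: of_nat_add of_nat_mult of_nat_numeral of_nat_1 sub s_def q_def[symmetric])
  then have "(q - 1) * (2 * r 2 + 6 * r 3) = (q - 1) * (q * (q + 1) + s * q)"
    using M[of 2] M[of 3] by (simp add: algebra_simps)
  then have "2 * r 2 + 6 * r 3 = q * (q + 1) + s * q" using q by simp
  then show r3: "r 3 = (q * (q + 1) + s * q - 2 * (t - m)) / 6" using r2 by simp
  have "of_nat (perp_count p 1) + 2 * of_nat (perp_count p 2) + 3 * of_nat (perp_count p 3)
      = (q + 1) * ((q - 1) * (q + 1))"
    using arg_cong[OF perp_count_incidences[OF assms(2,3)], of "of_nat :: nat \<Rightarrow> rat"]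
    by (simp only: of_nat_add of_nat_mult of_nat_numeral of_nat_1 sub q_def[symmetric])
  then have "(q - 1) * (r 1 + m + 2 * r 2 + 3 * r 3) = (q - 1) * (q + 1)\<^sup>2"
    using M[of 1] M[of 2] M[of 3] by (simp add: algebra_simps power2_eq_square)
  then have "r 1 + m + 2 * r 2 + 3 * r 3 = (q + 1)\<^sup>2" using q by simp
  then show r1: "r 1 = (q + 1)\<^sup>2 - m - 2 * (t - m) - (q * (q + 1) + s * q - 2 * (t - m)) / 2"
    unfolding r2 r3 by (simp add: field_simps)
  have "of_nat (perp_count p 0) + of_nat (perp_count p 1) + of_nat (perp_count p 2) + of_nat (perp_count p 3)
      = (q - 1) * (q ^ 2 + q + 1)"
    using arg_cong[OF perp_count_total[OF assms(2)], of "of_nat :: nat \<Rightarrow> rat"]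
    by (simp only: of_nat_add sub)
  then have "(q - 1) * (r 0 + (r 1 + m) + r 2 + r 3) = (q - 1) * (q ^ 2 + q + 1)"
    using M[of 0] M[of 1] M[of 2] M[of 3] by (simp add: algebra_simps)
  then have "r 0 + (r 1 + m) + r 2 + r 3 = q ^ 2 + q + 1" using q by simp
  then show "r 0 = (t - m) - q + (q * (q + 1) + s * q - 2 * (t - m)) / 3"
    using r1 r2 r3 by (simp add: power2_eq_square field_simps)
qed

end

section \<open>The plane numbers for the points of the classes 1 and 2\<close>

theorem proposition3p8:
  fixes n h q :: nat and \<xi> :: int
    and r1 r2 :: "nat \<Rightarrow> rat"
  assumes "n \<ge> 3" and "q = 2 ^ n" and "CARD('a::{field,finite}) = q"
    and "h > 0" and "gcd n h = 1"
    and "\<xi> \<in> {1, -1}" and "[int q = \<xi>] (mod 3)"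
    and r1_def: "r1 = (\<lambda>d.
        if d = q + 1 then 1
        else if d = 0 then of_nat q * (of_nat q - of_int \<xi>) / 3
        else if d = 1 then of_nat q * (of_nat q + of_int \<xi>) / 2
        else if d = 2 then of_nat q
        else of_nat q * (of_nat q - of_int \<xi>) / 6)"
    and r2_def: "r2 = (\<lambda>d.
        if d = q + 1 then 2
        else if d = 0 then (of_nat q ^ 2 - 1) / 3
        else if d = 1 then of_nat q * (of_nat q - 1) / 2
        else if d = 2 then 2 * of_nat q - 1
        else (of_nat q ^ 2 - 3 * of_nat q + 2) / 6)"
  shows "\<forall>d \<in> {0, 1, 2, 3, q + 1}.
      (\<forall>P \<in> (point_class h 1 :: ('a ^ 4) set set).
          of_nat (card {\<pi> \<in> plane_class h d. P \<subseteq> \<pi>}) = r1 d) \<and>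
      (\<forall>P \<in> (point_class h 2 :: ('a ^ 4) set set).
          of_nat (card {\<pi> \<in> plane_class h d. P \<subseteq> \<pi>}) = r2 d)"
proof -
  have card: "CARD('a) = 2 ^ n" using assms(2,3) by simp
  have "coprime h n" using assms(5) by (simp add: coprime_iff_gcd_eq_1 gcd.commute)
  note char = CHAR_eq_two[OF card]
  interpret frobenius_power_arc "\<lambda>x::'a. x ^ (2 ^ h)" h
  proof
    show "(x + y) ^ 2 ^ h = x ^ 2 ^ h + y ^ 2 ^ h" for x y :: 'a
      by (rule freshmans_dream') (simp_all add: char)
    show "x + x = 0" for x :: 'a by (rule add_self_eq_0[OF char])
  qed (use two_power_fixed[OF card \<open>coprime h n\<close> \<open>h > 0\<close>] in \<open>auto simp: power_mult_distrib\<close>)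
  have "(8::nat) \<le> 2 ^ n" using power_increasing[OF assms(1), of "2::nat"] by simp
  then have q8: "q \<ge> 8" using assms(2) by simp
  have q3: "CARD('a) \<ge> 3" using q8 assms(3) by simp

  have \<xi>: "\<xi> = (if even n then 1 else -1)"
  proof -
    \<comment> \<open>Since 2 is -1 modulo 3, \<xi> records the parity of \<open>n\<close>.\<close>
    have "[int q = (- 1) ^ n] (mod 3)"
      unfolding assms(2) of_nat_power by (rule cong_pow) (simp add: cong_def)
    then have "[\<xi> = (- 1) ^ n] (mod 3)" using assms(7) cong_sym cong_trans by blast
    then show ?thesis using assms(6) by (auto simp: cong_def)
  qed
  have "(\<exists>z::'a. z ^ 2 ^ h + z = 1) \<longleftrightarrow> even n"
  proof
    assume "even n"
    then have "odd h" using assms(5) by (metis even_plus_one_iff gcd_greatest odd_one)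
    then show "\<exists>z::'a. z ^ 2 ^ h + z = 1"
      using shifted_fixed_point_exists[OF card] \<open>even n\<close> assms(1) by auto
  qed (use shifted_fixed_point_even[OF card] in auto)
  \<comment> \<open>The number of ordered chords through a point of class 1 becomes 1 -
    \<xi>.\<close>
  then have secants: "of_nat (if \<exists>z::'a. z ^ 2 ^ h + z = 1 then 0 else 2) = (1 - of_int \<xi> :: rat)"
    by (simp add: \<xi>)

  have one: "of_nat (card {\<pi> \<in> plane_class h d. P \<subseteq> \<pi>}) = r1 d"
    if P: "P \<in> point_class h 1" and d: "d \<in> {0, 1, 2, 3, q + 1}" for P :: "('a ^ 4) set" and d
  proof -
    obtain p where p: "P = vec.span {p}" "p \<noteq> 0" "\<not> on_arc p" "card (roots p) = 1"
      using P q3 by (auto simp: point_class_eq)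
    \<comment> \<open>Here \<open>m = 1\<close>, \<open>t = q + 1\<close> and
      \<open>s = 1 - \<xi>\<close>.\<close>
    note counts = plane_counts[OF q3 p(2,3), unfolded card_zero_pairs_one_root[OF p(3,4)]
        secant_count_one_root[OF p(3,4)] secants p(4) p(1)[symmetric] assms(3)]
    show ?thesis
      using d q8 counts unfolding r1_def
      by (elim insertE emptyE) (simp_all add: field_simps power2_eq_square)
  qed
  have two: "of_nat (card {\<pi> \<in> plane_class h d. P \<subseteq> \<pi>}) = r2 d"
    if P: "P \<in> point_class h 2" and d: "d \<in> {0, 1, 2, 3, q + 1}" for P :: "('a ^ 4) set" and d
  proof -
    obtain p where p: "P = vec.span {p}" "p \<noteq> 0" "\<not> on_arc p" "card (roots p) = 2"
      using P q3 by (auto simp: point_class_eq)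
    then obtain c i j where c: "c \<noteq> 0" "i \<noteq> j" "p = c *s w i j"
      using card_roots_eq_two_iff by blast
    have t: "card {(k, l). sform p (w k l) = 0} = 2 * CARD('a) + 1" "secant_count p = 0"
      unfolding c(3) by (rule card_zero_pairs_two_roots[OF c(1)] secant_count_two_roots[OF c(1,2)])+
    \<comment> \<open>Here \<open>m = 2\<close>, \<open>t = 2 * q + 1\<close> and
      \<open>s = 0\<close>.\<close>
    note counts = plane_counts[OF q3 p(2,3), unfolded t p(4) p(1)[symmetric] assms(3)]
    show ?thesis
      using d q8 counts unfolding r2_def
      by (elim insertE emptyE) (simp_all add: field_simps power2_eq_square)
  qed
  show ?thesis using one two by blast
qed

end
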